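(* Let $0<p<\infty$, and suppose that either (a) $w\in D_q$ with $0<q<p$, and $s=\infty$; or (b) $w\in A_{q,r}$ with $0<q<p$ and $1<r<\infty$, and $\max\{rp/(r-1),1\}\le s\le\infty$. Suppose that an operator $T$ is defined for every $(p,s,w)$-block and that there is a constant $C$ such that, for every $(p,s,w)$-block $h$ with $\operatorname{supp}h\subset Q$, $Q$ a cube with center $x_0$, $$|Th(x)|\le C\frac{\|h\|_{L^1}}{|x-x_0|^n}\quad\text{for almost all }x\in(2n^{1/2}Q)^c,\qquad \|Th\|_{L^s(2n^{1/2}Q)}\le C\|h\|_{L^s(Q)} .$$ (i) If $T$ is a linear operator, then $T$ has a unique bounded extension (still denoted by $T$) from $BL^{p,s}_w$ to $L^p_w$ that satisfies $$T\Big(\sum_{j=1}^\infty\lambda_ja_j\Big)(x)=\sum_{j=1}^\infty\lambda_jTa_j(x)$$ in $L^p_w$ and $w$-a.e., and $\|Tf\|_{L^p_w}\le C\|f\|_{BL^{p,s}_w}$, for all $f=\sum_{j=1}^\infty\lambda_ja_j\in BL^{p,s}_w$. (ii) If $T$ is a sublinear operator satisfying $|Tf(x)|\le\sum_j|\lambda_j||Ta_j(x)|$ $w$-a.e. for every $f=\sum_j\lambda_ja_j\in BL^{p,s}_w$, then $T$ is bounded from $BL^{p,s}_w$ to $L^p_w$ and $\|Tf\|_{L^p_w}\le C\|f\|_{BL^{p,s}_w}$ for all $f\in BL^{p,s}_w$.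
   Context: A weight is a nonnegative locally integrable function on $\mathbf{R}^n$; $w(E)=\int_E w$, $L^p_w=L^p(\mathbf{R}^n,w\,dx)$, $L^s=L^s(\mathbf{R}^n)$. For a cube $Q$ and $\lambda>0$, $\lambda Q$ is the concentric cube with edges $\lambda$ times as long. $\bar p=\min\{p,1\}$. A property holds $w$-a.e. if it holds off a set $E$ with $w(E)=0$. $w\in D_q$ ($0<q<\infty$) means there is $C$ with $w(\lambda Q)\le C\lambda^{nq}w(Q)$ for all cubes $Q$ and all $\lambda>1$. $w\in RH_r$ ($1<r<\infty$) means there is $C$ with $\left(\frac1{|Q|}\int_Q w^r\right)^{1/r}\le \frac{C}{|Q|}\int_Q w$ for all cubes $Q$. $A_{q,r}=D_q\cap RH_r$. A function $a$ is a $(p,s,w)$-block if there is a cube $Q$ with $\operatorname{supp} a\subseteq Q$ and $\|a\|_{L^s}\le |Q|^{1/s}w(Q)^{-1/p}$. $B^{p,s}_w$ is the space of functions $f=\sum_{k=1}^\infty\lambda_k h_k$ with $h_k$ $(p,s,w)$-blocks and $\lambda_k$ real, $\sum_k|\lambda_k|^{\bar p}<\infty$, with quasi-norm $\|f\|_{B^{p,s}_w}=\inf(\sum_k|\lambda_k|^{\bar p})^{1/\bar p}$ over all such decompositions. The notation $BL^{p,s}_w$ stands for $B^{p,s}_w$ (same quasi-norm) when $0<p<\infty$ and either $w\in RH_r$ with $1<r<\infty$ and $rp/(r-1)\le s\le\infty$, or $w$ is any weight and $s=\infty$; in these ranges the series converge in $L^p_w$ and $w$-a.e., and $BL^{p,s}_w\subset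 L^p_w$. Writing "$f=\sum_j\lambda_ja_j\in BL^{p,s}_w$" means each $a_j$ is a $(p,s,w)$-block and $\sum_j|\lambda_j|^{\bar p}<\infty$.
   Formalization: In (i) with s=∞ it is additionally assumed that |Th| ≤ Σ|λ_j||Ta_j| w-a.e. whenever a block h equals a block series Σλ_j a_j; without this (i) fails for s=∞ (e.g. w=1, p>1), and the condition is necessary for the extension to exist. *)

theory Defs
  imports "HOL-Analysis.Analysis" "HOL-Probability.Essential_Supremum"
begin

text \<open>
  The space \<open>R^n\<close> is \<open>real ^ 'n\<close> with \<open>n = CARD('n)\<close>. Functions are total real-valued functions;
  equalities between them are stated almost everywhere, either for Lebesgue measure or for the
  measure \<open>w dx\<close>. Exponents that may be infinite have type \<open>ennreal\<close>.
\<close>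

section \<open>Cubes and weights\<close>

text \<open>The closed cube with centre \<open>c\<close>, edge length \<open>l\<close> and edges parallel to the axes. The
  dilated cube \<open>\<lambda> Q\<close> is \<open>cube c (\<lambda> * l)\<close>.\<close>

definition cube :: "real ^ 'n \<Rightarrow> real \<Rightarrow> (real ^ 'n) set" where
  "cube c l = {x. \<forall>i. \<bar>x $ i - c $ i\<bar> \<le> l / 2}"

definition weight :: "(real ^ 'n \<Rightarrow> real) \<Rightarrow> bool" where
  "weight w \<longleftrightarrow> (\<forall>x. 0 \<le> w x) \<and> (\<forall>K. compact K \<longrightarrow> set_integrable lebesgue K w)"

definition wm :: "(real ^ 'n \<Rightarrow> real) \<Rightarrow> (real ^ 'n) measure" where
  "wm w = density lebesgue (\<lambda>x. ennreal (w x))"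

definition D_class :: "real \<Rightarrow> (real ^ 'n \<Rightarrow> real) \<Rightarrow> bool" where
  "D_class q w \<longleftrightarrow> (\<exists>C. \<forall>c l t. 0 < l \<longrightarrow> 1 < t \<longrightarrow>
     measure (wm w) (cube c (t * l)) \<le> C * t powr (real CARD('n) * q) * measure (wm w) (cube c l))"
  for w :: "real ^ 'n \<Rightarrow> real"

text \<open>Integrability of \<open>w^r\<close> on the cube has to be stated, because a divergent Bochner integral
  has the value 0.\<close>

definition RH_class :: "real \<Rightarrow> (real ^ 'n \<Rightarrow> real) \<Rightarrow> bool" where
  "RH_class r w \<longleftrightarrow> (\<exists>C. \<forall>c l. 0 < l \<longrightarrow>
     set_integrable lebesgue (cube c l) (\<lambda>x. w x powr r) \<and>
     (1 / measure lebesgue (cube c l) * (LINT x:cube c l|lebesgue. w x powr r)) powr (1 / r)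
       \<le> C / measure lebesgue (cube c l) * (LINT x:cube c l|lebesgue. w x))"

definition A_class :: "real \<Rightarrow> real \<Rightarrow> (real ^ 'n \<Rightarrow> real) \<Rightarrow> bool" where
  "A_class q r w \<longleftrightarrow> D_class q w \<and> RH_class r w"

section \<open>Lebesgue spaces\<close>

definition Lnorm :: "'a measure \<Rightarrow> ennreal \<Rightarrow> ('a \<Rightarrow> real) \<Rightarrow> ennreal" where
  "Lnorm M s f =
     (if s = top then esssup M (\<lambda>x. ennreal \<bar>f x\<bar>)
      else let I = (\<integral>\<^sup>+x. ennreal (\<bar>f x\<bar> powr enn2real s) \<partial>M)
           in if I = top then top else ennreal (enn2real I powr (1 / enn2real s)))"

definition Lspace :: "'a measure \<Rightarrow> ennreal \<Rightarrow> ('a \<Rightarrow> real) set" where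
  "Lspace M s = {f \<in> borel_measurable M. Lnorm M s f < top}"

section \<open>Blocks and block spaces\<close>

text \<open>The right-hand side of the size condition is infinite when \<open>w(Q) = 0\<close> (\<open>inverse 0 = top\<close>);
  \<open>enn2real (inverse s)\<close> is \<open>1/s\<close>, with value 0 at \<open>s = top\<close>.\<close>

definition block :: "real \<Rightarrow> ennreal \<Rightarrow> (real ^ 'n \<Rightarrow> real) \<Rightarrow> (real ^ 'n \<Rightarrow> real) \<Rightarrow> bool" where
  "block p s w a \<longleftrightarrow> a \<in> Lspace lebesgue s \<and>
     (\<exists>c l. 0 < l \<and> closure {x. a x \<noteq> 0} \<subseteq> cube c l \<and>
        Lnorm lebesgue s a \<le> ennreal (measure lebesgue (cube c l) powr enn2real (inverse s))
                             * inverse (ennreal (measure (wm w) (cube c l) powr (1 / p))))"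

text \<open>The relation \<open>f = \<Sum>\<^sub>j \<lambda>\<^sub>j a\<^sub>j\<close> with blocks \<open>a\<^sub>j\<close> and \<open>\<Sum>\<^sub>j |\<lambda>\<^sub>j|^min(p,1) < \<infinity>\<close>; the sum is
  taken \<open>w\<close>-almost everywhere.\<close>

definition block_series ::
  "real \<Rightarrow> ennreal \<Rightarrow> (real ^ 'n \<Rightarrow> real) \<Rightarrow> (nat \<Rightarrow> real) \<Rightarrow> (nat \<Rightarrow> real ^ 'n \<Rightarrow> real)
   \<Rightarrow> (real ^ 'n \<Rightarrow> real) \<Rightarrow> bool" where
  "block_series p s w lam a f \<longleftrightarrow>
     (\<forall>j. block p s w (a j)) \<and> summable (\<lambda>j. \<bar>lam j\<bar> powr min p 1) \<and>
     f \<in> borel_measurable lebesgue \<and> (AE x in wm w. (\<lambda>j. lam j * a j x) sums f x)"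

definition BL :: "real \<Rightarrow> ennreal \<Rightarrow> (real ^ 'n \<Rightarrow> real) \<Rightarrow> (real ^ 'n \<Rightarrow> real) set" where
  "BL p s w = {f. \<exists>lam a. block_series p s w lam a f}"

definition BL_norm :: "real \<Rightarrow> ennreal \<Rightarrow> (real ^ 'n \<Rightarrow> real) \<Rightarrow> (real ^ 'n \<Rightarrow> real) \<Rightarrow> real" where
  "BL_norm p s w f =
     Inf {(\<Sum>j. \<bar>lam j\<bar> powr min p 1) powr (1 / min p 1) | lam a. block_series p s w lam a f}"

section \<open>Operators\<close>

definition block_estimates ::
  "real \<Rightarrow> ennreal \<Rightarrow> (real ^ 'n \<Rightarrow> real) \<Rightarrow> real
   \<Rightarrow> ((real ^ 'n \<Rightarrow> real) \<Rightarrow> real ^ 'n \<Rightarrow> real) \<Rightarrow> bool" where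
  "block_estimates p s w C T \<longleftrightarrow>
     (\<forall>h c l. block p s w h \<longrightarrow> 0 < l \<longrightarrow> closure {x. h x \<noteq> 0} \<subseteq> cube c l \<longrightarrow>
        (AE x in lebesgue. x \<notin> cube c (2 * sqrt (real CARD('n)) * l) \<longrightarrow>
           ennreal \<bar>T h x\<bar> \<le> ennreal C * Lnorm lebesgue 1 h / ennreal (norm (x - c) ^ CARD('n))) \<and>
        Lnorm (lebesgue_on (cube c (2 * sqrt (real CARD('n)) * l))) s (T h)
          \<le> ennreal C * Lnorm (lebesgue_on (cube c l)) s h)"

text \<open>The blocks do not form a vector space. An operator that is defined for blocks is linear if it
  preserves every linear relation between blocks, that is, if it is the restriction to the blocks
  of a linear operator on their linear span.\<close>

definition linear_on_blocks ::
  "real \<Rightarrow> ennreal \<Rightarrow> (real ^ 'n \<Rightarrow> real) \<Rightarrow> ((real ^ 'n \<Rightarrow> real) \<Rightarrow> real ^ 'n \<Rightarrow> real) \<Rightarrow> bool" where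
  "linear_on_blocks p s w T \<longleftrightarrow>
     (\<forall>h a (lam :: nat \<Rightarrow> real) N. block p s w h \<longrightarrow> (\<forall>j<N. block p s w (a j)) \<longrightarrow>
        h = (\<lambda>x. \<Sum>j<N. lam j * a j x) \<longrightarrow>
        (AE x in lebesgue. T h x = (\<Sum>j<N. lam j * T (a j) x)))"

definition sublinear_on_BL ::
  "real \<Rightarrow> ennreal \<Rightarrow> (real ^ 'n \<Rightarrow> real) \<Rightarrow> ((real ^ 'n \<Rightarrow> real) \<Rightarrow> real ^ 'n \<Rightarrow> real) \<Rightarrow> bool" where
  "sublinear_on_BL p s w T \<longleftrightarrow>
     (\<forall>f\<in>BL p s w. \<forall>g\<in>BL p s w. AE x in wm w. \<bar>T (\<lambda>y. f y + g y) x\<bar> \<le> \<bar>T f x\<bar> + \<bar>T g x\<bar>) \<and>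
     (\<forall>f\<in>BL p s w. \<forall>k. AE x in wm w. \<bar>T (\<lambda>y. k * f y) x\<bar> = \<bar>k\<bar> * \<bar>T f x\<bar>)"

text \<open>The inequality \<open>|T f| \<le> \<Sum>\<^sub>j |\<lambda>\<^sub>j| |T a\<^sub>j|\<close> (\<open>w\<close>-a.e.) for all \<open>f \<in> F\<close> and all block series
  \<open>f = \<Sum>\<^sub>j \<lambda>\<^sub>j a\<^sub>j\<close>. For a linear operator and \<open>s = \<infinity>\<close> it is needed for \<open>F\<close> the set of blocks.
  Finite linearity and the block estimates do not imply it there: with
  \<open>w = 1\<close> and \<open>p > 1\<close>, take open dense \<open>U\<^sub>1 \<supseteq> U\<^sub>2 \<supseteq> \<dots>\<close> of small measure and a limit, along an
  ultrafilter, of the averages of \<open>h\<close> over \<open>ball x (1/k) \<inter> U\<^sub>k\<close>. The inequality is necessary for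
  the existence of an extension which commutes with block series.\<close>

definition series_dominated ::
  "real \<Rightarrow> ennreal \<Rightarrow> (real ^ 'n \<Rightarrow> real) \<Rightarrow> (real ^ 'n \<Rightarrow> real) set
   \<Rightarrow> ((real ^ 'n \<Rightarrow> real) \<Rightarrow> real ^ 'n \<Rightarrow> real) \<Rightarrow> bool" where
  "series_dominated p s w F T \<longleftrightarrow>
     (\<forall>f\<in>F. \<forall>lam a. block_series p s w lam a f \<longrightarrow>
        (AE x in wm w. ennreal \<bar>T f x\<bar> \<le> (\<Sum>j. ennreal (\<bar>lam j\<bar> * \<bar>T (a j) x\<bar>))))"

definition bounded_BL_Lp ::
  "real \<Rightarrow> ennreal \<Rightarrow> (real ^ 'n \<Rightarrow> real) \<Rightarrow> ((real ^ 'n \<Rightarrow> real) \<Rightarrow> real ^ 'n \<Rightarrow> real) \<Rightarrow> bool" where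
  "bounded_BL_Lp p s w T \<longleftrightarrow>
     (\<forall>f\<in>BL p s w. T f \<in> Lspace (wm w) (ennreal p)) \<and>
     (\<exists>C. \<forall>f\<in>BL p s w. Lnorm (wm w) (ennreal p) (T f) \<le> ennreal (C * BL_norm p s w f))"

text \<open>\<open>S\<close> is a bounded linear operator on the \<open>w\<close>-a.e. classes of \<open>BL\<close>, it extends \<open>T\<close> from the
  blocks, and it commutes with block series.\<close>

definition bounded_series_extension ::
  "real \<Rightarrow> ennreal \<Rightarrow> (real ^ 'n \<Rightarrow> real) \<Rightarrow> ((real ^ 'n \<Rightarrow> real) \<Rightarrow> real ^ 'n \<Rightarrow> real)
   \<Rightarrow> ((real ^ 'n \<Rightarrow> real) \<Rightarrow> real ^ 'n \<Rightarrow> real) \<Rightarrow> bool" where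
  "bounded_series_extension p s w T S \<longleftrightarrow>
     (\<forall>f\<in>BL p s w. \<forall>g\<in>BL p s w. (AE x in wm w. f x = g x) \<longrightarrow> (AE x in wm w. S f x = S g x)) \<and>
     (\<forall>f\<in>BL p s w. \<forall>g\<in>BL p s w. \<forall>u v.
        AE x in wm w. S (\<lambda>y. u * f y + v * g y) x = u * S f x + v * S g x) \<and>
     (\<forall>h. block p s w h \<longrightarrow> (AE x in wm w. S h x = T h x)) \<and>
     bounded_BL_Lp p s w S \<and>
     (\<forall>f lam a. block_series p s w lam a f \<longrightarrow>
        (AE x in wm w. (\<lambda>j. lam j * T (a j) x) sums S f x) \<and>
        (\<lambda>N. Lnorm (wm w) (ennreal p) (\<lambda>x. (\<Sum>j<N. lam j * T (a j) x) - S f x)) \<longlonglongrightarrow> 0)"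

end

theory Submission
  imports Defs
begin

text \<open>
  Everything rests on one uniform estimate: \<open>\<integral> |T h|^p w \<le> A\<close> for all blocks \<open>h\<close>
  (\<open>block_image_Lp\<close>). Let \<open>Q\<close> be the cube of \<open>h\<close>, with edge \<open>l\<close>. On the dilated cube
  \<open>2 n^(1/2) Q\<close> the bound \<open>\<parallel>T h\<parallel>\<^sub>s \<le> C \<parallel>h\<parallel>\<^sub>s\<close> is turned into a bound in \<open>L^p_w\<close> by the doubling
  property, together with the reverse Hoelder inequality if \<open>s < \<infinity>\<close>. Off this cube
  \<open>|T h| \<le> C |Q| w(Q)^(-1/p) |x - x\<^sub>0|^(-n)\<close>; the dyadic shell at distance about \<open>2^k l\<close> has weight at
  most \<open>C 2^(knq) w(Q)\<close>, so it contributes at most \<open>C 2^(-kn(p-q))\<close>, and these numbers are summable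
  because \<open>q < p\<close>.

  The estimate passes from blocks to series: \<open>\<Sum>\<^sub>j |\<lambda>\<^sub>j| |T a\<^sub>j|\<close> converges \<open>w\<close>-a.e. and its norm in
  \<open>L^p_w\<close> is at most \<open>A^(1/p) (\<Sum>\<^sub>j |\<lambda>\<^sub>j|^min(p,1))^(1/min(p,1))\<close> (\<open>Lp_series\<close>). An operator which is
  dominated by these series is therefore bounded, after passing to the infimum over all
  representations (\<open>bounded_if_series_dominated\<close>); this settles the sublinear case.

  A linear \<open>T\<close> has to be extended by \<open>\<Sum>\<^sub>j \<lambda>\<^sub>j a\<^sub>j \<mapsto> \<Sum>\<^sub>j \<lambda>\<^sub>j T a\<^sub>j\<close>, and the point is that this is well
  defined: if \<open>\<Sum>\<^sub>j \<lambda>\<^sub>j a\<^sub>j = 0\<close> then \<open>\<Sum>\<^sub>j \<lambda>\<^sub>j T a\<^sub>j = 0\<close> (\<open>image_of_zero_series\<close>). The partial sum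
  \<open>g = \<Sum>\<^sub>j\<^sub><\<^sub>N \<lambda>\<^sub>j a\<^sub>j\<close> is a multiple of a block, so that \<open>T g = \<Sum>\<^sub>j\<^sub><\<^sub>N \<lambda>\<^sub>j T a\<^sub>j\<close> by finite linearity, and
  \<open>g\<close> is also minus the tail of the series. If the norm of \<open>T g\<close> is controlled by the coefficients of
  \<^emph>\<open>any\<close> block series that represents \<open>g\<close>, then \<open>T g\<close> tends to \<open>0\<close> with the tail.

  For \<open>s = \<infinity>\<close> this control is the assumption \<open>series_dominated\<close>. For \<open>s < \<infinity>\<close> it follows from the
  continuity of \<open>T\<close> in \<open>L^s\<close> (\<open>dominated_by_truncated_blocks\<close>): the blocks of the series are cut down
  so that the partial sums stay below \<open>|g|\<close> and converge to \<open>g\<close> in \<open>L^s\<close>. Here an identity that holds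
  \<open>w\<close>-a.e. is needed Lebesgue-a.e.; this is legitimate since doubling and the reverse Hoelder
  inequality force \<open>w > 0\<close> almost everywhere (\<open>weight_positive_AE\<close>), unless \<open>w\<close> vanishes almost
  everywhere.
\<close>

section \<open>Cubes\<close>

lemma cube_eq_cbox: "cube c l = cbox (\<chi> i. c $ i - l / 2) (\<chi> i. c $ i + l / 2)"
proof (intro set_eqI)
  fix x
  have "\<bar>x $ i - c $ i\<bar> \<le> l / 2 \<longleftrightarrow> c $ i - l / 2 \<le> x $ i \<and> x $ i \<le> c $ i + l / 2" for i
    by linarith
  then show "x \<in> cube c l \<longleftrightarrow> x \<in> cbox (\<chi> i. c $ i - l / 2) (\<chi> i. c $ i + l / 2)"
    by (simp add: cube_def mem_box_cart)
qed

lemma closed_cube [simp]: "closed (cube c l)" and compact_cube: "compact (cube c l)"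
  by (auto simp: cube_eq_cbox)

lemma cube_lmeasurable [simp]: "cube c l \<in> lmeasurable"
  by (simp add: cube_eq_cbox)

lemma sets_cube [measurable, simp]: "cube c l \<in> sets lebesgue"
  using cube_lmeasurable by (rule fmeasurableD)

lemma measure_cube:
  fixes c :: "real ^ 'n"
  assumes "0 < l"
  shows "measure lebesgue (cube c l) = l ^ CARD('n)" "measure lborel (cube c l) = l ^ CARD('n)"
proof -
  have "cbox (\<chi> i. c $ i - l / 2) (\<chi> i. c $ i + l / 2) \<noteq> {}"
    using assms by (auto simp: cube_eq_cbox[symmetric] cube_def intro!: exI[of _ c])
  then show "measure lebesgue (cube c l) = l ^ CARD('n)" "measure lborel (cube c l) = l ^ CARD('n)"
    by (simp_all add: cube_eq_cbox content_cbox_cart)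
qed

lemma emeasure_cube:
  fixes c :: "real ^ 'n"
  assumes "0 < l"
  shows "emeasure lebesgue (cube c l) = ennreal (l ^ CARD('n))"
    "emeasure lborel (cube c l) = ennreal (l ^ CARD('n))"
proof -
  show "emeasure lebesgue (cube c l) = ennreal (l ^ CARD('n))"
    using measure_cube(1)[OF assms, of c] emeasure_eq_measure2[OF cube_lmeasurable, of c l] by metis
  then show "emeasure lborel (cube c l) = ennreal (l ^ CARD('n))"
    by simp
qed

lemma cube_mono: "l \<le> l' \<Longrightarrow> cube c l \<subseteq> cube c l'"
  unfolding cube_def by (auto intro: order_trans)

lemma cube_subset_centred:
  fixes c :: "real ^ 'n"
  assumes "l + 2 * norm c \<le> L"
  shows "cube c l \<subseteq> cube 0 L"
proof
  fix x assume x: "x \<in> cube c l"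
  have "\<bar>x $ i\<bar> \<le> L / 2" for i
  proof -
    have "\<bar>x $ i - c $ i\<bar> \<le> l / 2" using x by (simp add: cube_def)
    moreover have "\<bar>c $ i\<bar> \<le> norm c" by (rule component_le_norm_cart)
    ultimately show ?thesis using assms by linarith
  qed
  then show "x \<in> cube 0 L" by (simp add: cube_def)
qed

lemma mem_cube_norm:
  assumes "2 * norm (x - c) \<le> l"
  shows "x \<in> cube c l"
  unfolding cube_def
proof (intro CollectI allI)
  show "\<bar>x $ i - c $ i\<bar> \<le> l / 2" for i
    using component_le_norm_cart[of "x - c" i] assms by simp
qed

lemma ex_centred_cube:
  fixes x :: "real ^ 'n"
  shows "\<exists>k::nat. x \<in> cube c (real k)"
proof -
  obtain k :: nat where "2 * norm (x - c) \<le> real k" using real_arch_simple by blast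
  then show ?thesis by (auto intro: mem_cube_norm)
qed

section \<open>Weights\<close>

lemma weight_measurable:
  fixes w :: "real ^ 'n \<Rightarrow> real"
  assumes "weight w"
  shows "w \<in> borel_measurable lebesgue"
proof (rule borel_measurable_LIMSEQ_real)
  show "(\<lambda>x. indicator (cube 0 (real k)) x *\<^sub>R w x) \<in> borel_measurable lebesgue" for k
    using assms compact_cube unfolding weight_def set_integrable_def by (auto dest!: spec)
  fix x :: "real ^ 'n"
  obtain k where k: "x \<in> cube 0 (real k)" using ex_centred_cube by blast
  have "eventually (\<lambda>j. indicator (cube 0 (real j)) x *\<^sub>R w x = w x) sequentially"
    using eventually_ge_at_top[of k]
  proof eventually_elim
    case (elim j)
    then have "x \<in> cube 0 (real j)" using k cube_mono[of "real k" "real j" 0] by auto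
    then show ?case by simp
  qed
  then show "(\<lambda>j. indicator (cube 0 (real j)) x *\<^sub>R w x) \<longlonglongrightarrow> w x"
    by (rule tendsto_eventually)
qed

lemma sets_wm [simp, measurable_cong]: "sets (wm w) = sets lebesgue"
  and space_wm [simp]: "space (wm w) = UNIV"
  by (auto simp: wm_def)

lemma emeasure_wm_cube:
  assumes "weight w"
  shows "emeasure (wm w) (cube c l) = (\<integral>\<^sup>+x\<in>cube c l. ennreal (w x) \<partial>lebesgue)"
    "emeasure (wm w) (cube c l) = ennreal (LINT x:cube c l|lebesgue. w x)"
    "emeasure (wm w) (cube c l) = ennreal (measure (wm w) (cube c l))"
    "measure (wm w) (cube c l) = (LINT x:cube c l|lebesgue. w x)"
proof -
  note [measurable] = weight_measurable[OF assms]
  show 1: "emeasure (wm w) (cube c l) = (\<integral>\<^sup>+x\<in>cube c l. ennreal (w x) \<partial>lebesgue)"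
    unfolding wm_def by (subst emeasure_density) auto
  have i: "set_integrable lebesgue (cube c l) w"
    using assms compact_cube by (auto simp: weight_def)
  have "(\<integral>\<^sup>+x\<in>cube c l. ennreal (w x) \<partial>lebesgue) = (\<integral>\<^sup>+x. ennreal (indicator (cube c l) x *\<^sub>R w x) \<partial>lebesgue)"
    by (intro nn_integral_cong) (auto split: split_indicator)
  also have "\<dots> = ennreal (LINT x:cube c l|lebesgue. w x)"
    unfolding set_lebesgue_integral_def
    using i assms by (intro nn_integral_eq_integral) (auto simp: set_integrable_def weight_def)
  finally show 2: "emeasure (wm w) (cube c l) = ennreal (LINT x:cube c l|lebesgue. w x)"
    using 1 by simp
  have nn: "0 \<le> (LINT x:cube c l|lebesgue. w x)"
    using assms unfolding set_lebesgue_integral_def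
    by (intro integral_nonneg_AE) (auto simp: weight_def)
  show 4: "measure (wm w) (cube c l) = (LINT x:cube c l|lebesgue. w x)"
    unfolding measure_def 2 using nn by simp
  show "emeasure (wm w) (cube c l) = ennreal (measure (wm w) (cube c l))"
    using 2 4 by simp
qed

lemma nn_integral_wm:
  assumes "weight w" "f \<in> borel_measurable lebesgue"
  shows "(\<integral>\<^sup>+x. f x \<partial>wm w) = (\<integral>\<^sup>+x. ennreal (w x) * f x \<partial>lebesgue)"
proof -
  note [measurable] = weight_measurable[OF assms(1)]
  show ?thesis unfolding wm_def using assms by (intro nn_integral_density) auto
qed

lemma AE_wm:
  assumes "weight w"
  shows "(AE x in wm w. P x) \<longleftrightarrow> (AE x in lebesgue. 0 < w x \<longrightarrow> P x)"
  unfolding wm_def using weight_measurable[OF assms] by (subst AE_density) auto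

lemma AE_wm_if_lebesgue:
  assumes "weight w" "AE x in lebesgue. P x"
  shows "AE x in wm w. P x"
  using assms by (auto simp: AE_wm elim: eventually_mono)

text \<open>If \<open>w(Q) = 0\<close> for a single cube, doubling gives \<open>w(t Q) = 0\<close> for all \<open>t > 1\<close>, and these
  cubes fill the space. The degenerate case \<open>w = 0\<close>, in which the size condition of a block is void,
  can thus be split off.\<close>

lemma wm_null_or_positive:
  fixes w :: "real ^ 'n \<Rightarrow> real"
  assumes w: "weight w" and D: "D_class q w"
  shows "(AE x in wm w. False) \<or> (\<forall>c l. 0 < l \<longrightarrow> 0 < measure (wm w) (cube c l))"
proof (rule disjCI)
  assume "\<not> (\<forall>c l. 0 < l \<longrightarrow> 0 < measure (wm w) (cube c l))"
  then obtain c l where l: "0 < l" and z: "measure (wm w) (cube c l) = 0"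
    by (metis measure_nonneg less_eq_real_def)
  obtain C where C: "\<And>c l t. 0 < l \<Longrightarrow> 1 < t \<Longrightarrow>
     measure (wm w) (cube c (t * l)) \<le> C * t powr (real CARD('n) * q) * measure (wm w) (cube c l)"
    using D by (auto simp: D_class_def)
  have n: "cube c (real (k+2) * l) \<in> null_sets (wm w)" for k :: nat
  proof -
    have "measure (wm w) (cube c (real (k+2) * l)) \<le> 0"
      using C[OF l, of "real (k+2)" c] z by simp
    then have "emeasure (wm w) (cube c (real (k+2) * l)) = 0"
      by (simp add: emeasure_wm_cube(3)[OF w] ennreal_neg)
    then show ?thesis by (intro null_setsI) auto
  qed
  have "(\<Union>k. cube c (real (k+2) * l)) = UNIV"
  proof -
    have "\<exists>k. x \<in> cube c (real (k+2) * l)" for x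
    proof -
      obtain k :: nat where k: "2 * norm (x - c) / l \<le> real k" using real_arch_simple by blast
      then have "2 * norm (x - c) \<le> real k * l" using l by (simp add: field_simps)
      also have "\<dots> \<le> real (k+2) * l" using l by (simp add: algebra_simps)
      finally show ?thesis by (auto intro: mem_cube_norm)
    qed
    then show ?thesis by auto
  qed
  moreover have "(\<Union>k. cube c (real (k+2) * l)) \<in> null_sets (wm w)"
    by (rule null_sets_UN) (rule n)
  ultimately have "UNIV \<in> null_sets (wm w)" by simp
  then show "AE x in wm w. False"
    by (intro AE_I'[where N=UNIV]) auto
qed

section \<open>Lebesgue norms\<close>

lemma Lnorm_ennreal:
  assumes "0 < p"
  shows "Lnorm M (ennreal p) f =
    (let I = (\<integral>\<^sup>+x. ennreal (\<bar>f x\<bar> powr p) \<partial>M) in if I = top then top else ennreal (enn2real I powr (1 / p)))"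
  using assms by (simp add: Lnorm_def Let_def)

text \<open>Working with the integral of the power avoids roots of extended real numbers.\<close>

lemma Lnorm_le_iff:
  assumes "0 < p" "0 \<le> b"
  shows "Lnorm M (ennreal p) f \<le> ennreal b \<longleftrightarrow> (\<integral>\<^sup>+x. ennreal (\<bar>f x\<bar> powr p) \<partial>M) \<le> ennreal (b powr p)"
proof (cases "\<integral>\<^sup>+x. ennreal (\<bar>f x\<bar> powr p) \<partial>M" rule: ennreal_cases)
  case (real r)
  have "r powr (1/p) \<le> b \<longleftrightarrow> r \<le> b powr p"
  proof
    assume "r powr (1/p) \<le> b"
    then have "(r powr (1/p)) powr p \<le> b powr p" using assms by (intro powr_mono2) auto
    then show "r \<le> b powr p" using real assms by (simp add: powr_powr)
  next
    assume "r \<le> b powr p"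
    then have "r powr (1/p) \<le> (b powr p) powr (1/p)" using real assms by (intro powr_mono2) auto
    then show "r powr (1/p) \<le> b" using assms by (simp add: powr_powr)
  qed
  then show ?thesis using real assms by (simp add: Lnorm_ennreal ennreal_le_iff)
next
  case top
  then show ?thesis using assms by (simp add: Lnorm_ennreal top_unique)
qed

lemma Lnorm_finite_iff:
  assumes "0 < p"
  shows "Lnorm M (ennreal p) f < top \<longleftrightarrow> (\<integral>\<^sup>+x. ennreal (\<bar>f x\<bar> powr p) \<partial>M) < top"
  using assms by (simp add: Lnorm_ennreal Let_def less_top)

lemma Lnorm_one:
  "Lnorm M 1 f = (\<integral>\<^sup>+x. ennreal \<bar>f x\<bar> \<partial>M)"
  using Lnorm_ennreal[of 1 M f] by (simp add: Let_def powr_one' less_top)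

lemma Lnorm_top: "Lnorm M top f = esssup M (\<lambda>x. ennreal \<bar>f x\<bar>)"
  by (simp add: Lnorm_def)

lemma Lnorm_top_le:
  "f \<in> borel_measurable M \<Longrightarrow> AE x in M. \<bar>f x\<bar> \<le> b \<Longrightarrow> Lnorm M top f \<le> ennreal b"
  unfolding Lnorm_top by (intro esssup_I) (auto intro: ennreal_leI elim!: eventually_mono)

lemma AE_le_Lnorm_top:
  assumes "Lnorm M top f \<le> ennreal b" "0 \<le> b"
  shows "AE x in M. \<bar>f x\<bar> \<le> b"
  using esssup_AE[of "\<lambda>x. ennreal \<bar>f x\<bar>" M]
proof eventually_elim
  case (elim x)
  then have "ennreal \<bar>f x\<bar> \<le> ennreal b" using assms(1) by (simp add: Lnorm_top)
  then show ?case using assms(2) by (simp add: ennreal_le_iff)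
qed

lemma exponent_cases:
  fixes s :: ennreal
  assumes "1 \<le> s"
  obtains (top) "s = top" | (real) \<sigma> where "s = ennreal \<sigma>" "1 \<le> \<sigma>"
proof (cases s rule: ennreal_cases)
  case (real r)
  then have "1 \<le> r" using assms by (metis ennreal_1 ennreal_le_iff)
  then show ?thesis using real that by blast
qed (use that in blast)

lemma Lnorm_mono:
  assumes "0 < s" and f: "f \<in> borel_measurable M" and le: "AE x in M. \<bar>f x\<bar> \<le> \<bar>g x\<bar>"
  shows "Lnorm M s f \<le> Lnorm M s g"
proof (cases s rule: ennreal_cases)
  case (real \<sigma>)
  then have \<sigma>: "0 < \<sigma>" using assms(1) by simp
  have I: "(\<integral>\<^sup>+x. ennreal (\<bar>f x\<bar> powr \<sigma>) \<partial>M) \<le> (\<integral>\<^sup>+x. ennreal (\<bar>g x\<bar> powr \<sigma>) \<partial>M)"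
    using le \<sigma> by (intro nn_integral_mono_AE) (auto intro!: ennreal_leI powr_mono2 elim!: eventually_mono)
  show ?thesis
  proof (cases "Lnorm M s g" rule: ennreal_cases)
    case (real b)
    then have "(\<integral>\<^sup>+x. ennreal (\<bar>g x\<bar> powr \<sigma>) \<partial>M) \<le> ennreal (b powr \<sigma>)"
      using \<sigma> \<open>s = ennreal \<sigma>\<close> by (subst Lnorm_le_iff[symmetric]) auto
    then show ?thesis
      using real \<sigma> \<open>s = ennreal \<sigma>\<close> I by (simp add: Lnorm_le_iff)
  qed simp
next
  case top
  have "(\<lambda>x. ennreal \<bar>f x\<bar>) \<in> borel_measurable M" using f by measurable
  then show ?thesis
    unfolding top Lnorm_top using le
    by (intro esssup_AE_mono) (auto intro: ennreal_leI elim!: eventually_mono)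
qed

lemma Lspace_mono:
  assumes "0 < s" "f \<in> borel_measurable M" "AE x in M. \<bar>f x\<bar> \<le> \<bar>g x\<bar>" "g \<in> Lspace M s"
  shows "f \<in> Lspace M s"
  using Lnorm_mono[OF assms(1-3)] assms(2,4) by (auto simp: Lspace_def)

lemma Lnorm_scale_le:
  assumes "0 < s" and f: "f \<in> borel_measurable M" and "Lnorm M s f \<le> ennreal b" "0 \<le> b"
  shows "Lnorm M s (\<lambda>x. k * f x) \<le> ennreal (\<bar>k\<bar> * b)"
proof (cases s rule: ennreal_cases)
  case (real \<sigma>)
  then have \<sigma>: "0 < \<sigma>" using assms(1) by simp
  have "(\<integral>\<^sup>+x. ennreal (\<bar>k * f x\<bar> powr \<sigma>) \<partial>M) = (\<integral>\<^sup>+x. ennreal (\<bar>k\<bar> powr \<sigma>) * ennreal (\<bar>f x\<bar> powr \<sigma>) \<partial>M)"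
    by (simp add: abs_mult powr_mult ennreal_mult)
  also have "\<dots> = ennreal (\<bar>k\<bar> powr \<sigma>) * (\<integral>\<^sup>+x. ennreal (\<bar>f x\<bar> powr \<sigma>) \<partial>M)"
    using f by (intro nn_integral_cmult) auto
  also have "\<dots> \<le> ennreal (\<bar>k\<bar> powr \<sigma>) * ennreal (b powr \<sigma>)"
    using assms \<sigma> real by (intro mult_left_mono) (auto simp: Lnorm_le_iff)
  also have "\<dots> = ennreal ((\<bar>k\<bar> * b) powr \<sigma>)"
    using assms by (simp add: powr_mult ennreal_mult)
  finally show ?thesis using assms \<sigma> real by (simp add: Lnorm_le_iff)
next
  case top
  have "AE x in M. \<bar>f x\<bar> \<le> b"
    using assms top by (intro AE_le_Lnorm_top) auto
  then show ?thesis
    unfolding top using f assms by (intro Lnorm_top_le) (auto simp: abs_mult intro: mult_left_mono elim!: eventually_mono)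
qed

lemma Lspace_scale:
  assumes "0 < s" "f \<in> Lspace M s"
  shows "(\<lambda>x. k * f x) \<in> Lspace M s"
proof -
  obtain b where "0 \<le> b" "Lnorm M s f = ennreal b"
    using assms(2) by (cases "Lnorm M s f" rule: ennreal_cases) (auto simp: Lspace_def)
  then have "Lnorm M s (\<lambda>x. k * f x) \<le> ennreal (\<bar>k\<bar> * b)"
    using assms by (intro Lnorm_scale_le) (auto simp: Lspace_def)
  then show ?thesis using assms by (auto simp: Lspace_def intro: le_less_trans)
qed

lemma Lspace_add:
  assumes "0 < s" "f \<in> Lspace M s" "g \<in> Lspace M s"
  shows "(\<lambda>x. f x + g x) \<in> Lspace M s"
proof -
  have [measurable]: "f \<in> borel_measurable M" "g \<in> borel_measurable M"
    using assms by (auto simp: Lspace_def)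
  have "Lnorm M s (\<lambda>x. f x + g x) < top"
  proof (cases s rule: ennreal_cases)
    case (real \<sigma>)
    then have \<sigma>: "0 < \<sigma>" using assms(1) by simp
    have pt: "\<bar>x + y\<bar> powr \<sigma> \<le> 2 powr \<sigma> * \<bar>x\<bar> powr \<sigma> + 2 powr \<sigma> * \<bar>y\<bar> powr \<sigma>" for x y :: real
    proof -
      have "\<bar>x + y\<bar> powr \<sigma> \<le> (2 * max \<bar>x\<bar> \<bar>y\<bar>) powr \<sigma>" using \<sigma> by (intro powr_mono2) auto
      also have "\<dots> = 2 powr \<sigma> * max \<bar>x\<bar> \<bar>y\<bar> powr \<sigma>" by (subst powr_mult) auto
      also have "\<dots> \<le> 2 powr \<sigma> * \<bar>x\<bar> powr \<sigma> + 2 powr \<sigma> * \<bar>y\<bar> powr \<sigma>"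
        by (auto simp: max_def)
      finally show ?thesis .
    qed
    have "(\<integral>\<^sup>+x. ennreal (\<bar>f x + g x\<bar> powr \<sigma>) \<partial>M) \<le>
       (\<integral>\<^sup>+x. ennreal (2 powr \<sigma>) * ennreal (\<bar>f x\<bar> powr \<sigma>) + ennreal (2 powr \<sigma>) * ennreal (\<bar>g x\<bar> powr \<sigma>) \<partial>M)"
      using pt by (intro nn_integral_mono) (simp add: ennreal_mult[symmetric] ennreal_plus[symmetric] ennreal_leI del: ennreal_plus)
    also have "\<dots> = ennreal (2 powr \<sigma>) * (\<integral>\<^sup>+x. ennreal (\<bar>f x\<bar> powr \<sigma>) \<partial>M) + ennreal (2 powr \<sigma>) * (\<integral>\<^sup>+x. ennreal (\<bar>g x\<bar> powr \<sigma>) \<partial>M)"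
      by (subst nn_integral_add) (auto simp: nn_integral_cmult)
    also have "\<dots> < top"
      using assms(2,3) \<sigma> unfolding Lspace_def real
      by (auto simp: Lnorm_finite_iff ennreal_mult_less_top)
    finally show ?thesis using \<sigma> real by (simp add: Lnorm_finite_iff)
  next
    case top
    obtain a b where ab: "0 \<le> a" "0 \<le> b" "Lnorm M top f = ennreal a" "Lnorm M top g = ennreal b"
      using assms(2,3) top
      by (cases "Lnorm M top f" rule: ennreal_cases; cases "Lnorm M top g" rule: ennreal_cases) (auto simp: Lspace_def)
    have "AE x in M. \<bar>f x\<bar> \<le> a" "AE x in M. \<bar>g x\<bar> \<le> b"
      using ab by (auto intro!: AE_le_Lnorm_top)
    then have "AE x in M. \<bar>f x + g x\<bar> \<le> a + b"
      by eventually_elim linarith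
    then have "Lnorm M top (\<lambda>x. f x + g x) \<le> ennreal (a + b)" by (intro Lnorm_top_le) auto
    then show ?thesis using top by (auto intro: le_less_trans)
  qed
  then show ?thesis by (simp add: Lspace_def)
qed

lemma Lnorm_zero [simp]: "0 < s \<Longrightarrow> Lnorm M s (\<lambda>x. 0) = 0"
proof (cases s rule: ennreal_cases)
  case (real r)
  assume "0 < s"
  with real show ?thesis by (simp add: Lnorm_ennreal)
next
  case top
  have "Lnorm M top (\<lambda>x. 0) \<le> ennreal 0" by (rule Lnorm_top_le) auto
  then show ?thesis using top by simp
qed

lemma Lspace_zero: "0 < s \<Longrightarrow> (\<lambda>x. 0) \<in> Lspace M s"
  by (simp add: Lspace_def)

lemma Lspace_sum:
  assumes "0 < s" "\<And>j. j < N \<Longrightarrow> f j \<in> Lspace M s"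
  shows "(\<lambda>x. \<Sum>j<N::nat. lam j * f j x) \<in> Lspace M s"
  using assms(2)
proof (induction N)
  case 0
  then show ?case using assms(1) by (simp add: Lspace_zero)
next
  case (Suc N)
  then show ?case
    using Lspace_add[OF assms(1) Suc.IH Lspace_scale[OF assms(1), of "f N" M "lam N"]] by simp
qed

lemma Lnorm_restrict_le:
  assumes "0 < s" "f \<in> borel_measurable lebesgue" "S \<in> sets lebesgue"
  shows "Lnorm (lebesgue_on S) s f \<le> Lnorm lebesgue s f"
proof (cases s rule: ennreal_cases)
  case (real \<sigma>)
  then have \<sigma>: "0 < \<sigma>" using assms(1) by simp
  have I: "(\<integral>\<^sup>+x. ennreal (\<bar>f x\<bar> powr \<sigma>) \<partial>lebesgue_on S) \<le> (\<integral>\<^sup>+x. ennreal (\<bar>f x\<bar> powr \<sigma>) \<partial>lebesgue)"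
    using assms(3) by (subst nn_integral_restrict_space) (auto intro!: nn_integral_mono split: split_indicator)
  show ?thesis
  proof (cases "Lnorm lebesgue s f" rule: ennreal_cases)
    case (real b)
    then have "(\<integral>\<^sup>+x. ennreal (\<bar>f x\<bar> powr \<sigma>) \<partial>lebesgue) \<le> ennreal (b powr \<sigma>)"
      using \<sigma> \<open>s = ennreal \<sigma>\<close> by (subst Lnorm_le_iff[symmetric]) auto
    then show ?thesis
      using real \<sigma> \<open>s = ennreal \<sigma>\<close> I by (simp add: Lnorm_le_iff)
  qed simp
next
  case top
  show ?thesis
  proof (cases "Lnorm lebesgue s f" rule: ennreal_cases)
    case (real b)
    then have "AE x in lebesgue. \<bar>f x\<bar> \<le> b" using top by (intro AE_le_Lnorm_top) auto
    then have "AE x in lebesgue_on S. \<bar>f x\<bar> \<le> b"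
      using assms(3) by (subst AE_restrict_space_iff) auto
    then show ?thesis
      unfolding real unfolding top using assms(2) by (intro Lnorm_top_le) (auto intro: measurable_restrict_space1)
  qed simp
qed

section \<open>Series of uniformly bounded functions in L^p\<close>

text \<open>For \<open>p \<le> 1\<close> this is subadditivity of \<open>t^p\<close>: each \<open>y\<^sub>j = l\<^sub>j x\<^sub>j\<close> satisfies
  \<open>y\<^sub>j^p \<ge> y\<^sub>j S^(p-1)\<close> with \<open>S = \<Sum> y\<^sub>j\<close>. For \<open>p > 1\<close> it is Jensen's inequality for \<open>t^p\<close> with the
  weights \<open>l\<^sub>j / \<Sum> l\<^sub>j\<close>. Since the right-hand side is linear in \<open>x\<^sub>j^p\<close>, it can be integrated
  term by term, which treats both ranges of \<open>p\<close> at once and replaces Minkowski's inequality.\<close>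

lemma sum_powr_le_powr_sum:
  fixes x l :: "nat \<Rightarrow> real"
  assumes p: "0 < p" and x: "\<And>j. 0 \<le> x j" and l: "\<And>j. 0 \<le> l j"
  defines "e \<equiv> min p 1"
  shows "(\<Sum>j<N. l j * x j) powr p
    \<le> (\<Sum>j<N. l j powr e) powr (p / e - 1) * (\<Sum>j<N. l j powr e * x j powr p)"
proof (cases "(\<Sum>j<N. l j * x j) = 0")
  case True
  then show ?thesis using p by (auto intro!: mult_nonneg_nonneg sum_nonneg)
next
  case False
  define S where "S = (\<Sum>j<N. l j * x j)"
  have S: "0 < S" using False x l by (simp add: S_def sum_nonneg less_le)
  show ?thesis
  proof (cases "p \<le> 1")
    case True
    then have e: "e = p" by (simp add: e_def)
    have "l j * x j * S powr (p - 1) \<le> l j powr p * x j powr p" if j: "j < N" for j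
    proof (cases "l j * x j = 0")
      case False
      have "l j * x j \<le> S" unfolding S_def using j x l by (intro member_le_sum) auto
      then have "S powr (p - 1) \<le> (l j * x j) powr (p - 1)"
        using False True x[of j] l[of j] by (intro powr_mono2') (auto simp: less_le)
      then have "l j * x j * S powr (p - 1) \<le> (l j * x j) * (l j * x j) powr (p - 1)"
        using x l by (intro mult_left_mono) auto
      also have "\<dots> = (l j * x j) powr p"
        using False x[of j] l[of j] by (simp add: powr_mult_base)
      finally show ?thesis using x l by (simp add: powr_mult)
    qed (use p in auto)
    then have "(\<Sum>j<N. l j * x j * S powr (p - 1)) \<le> (\<Sum>j<N. l j powr p * x j powr p)"
      by (intro sum_mono) auto
    moreover have "(\<Sum>j<N. l j * x j * S powr (p - 1)) = S powr p"
      using S by (simp add: sum_distrib_right[symmetric] S_def[symmetric] powr_mult_base)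
    moreover have "(\<Sum>j<N. l j powr p) \<noteq> 0"
    proof
      assume "(\<Sum>j<N. l j powr p) = 0"
      then have "\<forall>j<N. l j = 0" by (subst (asm) sum_nonneg_eq_0_iff) auto
      then show False using S by (simp add: S_def)
    qed
    ultimately show ?thesis using p by (simp add: e S_def)
  next
    case False
    then have e: "e = 1" and p1: "1 < p" by (auto simp: e_def)
    \<comment> \<open>\<open>powr_convex\<close> is about positive arguments, so the vanishing terms are dropped.\<close>
    define I where "I = {j. j < N \<and> 0 < l j \<and> 0 < x j}"
    define L where "L = (\<Sum>j\<in>I. l j)"
    have fin: "finite I" by (simp add: I_def)
    have SI: "S = (\<Sum>j\<in>I. l j * x j)"
      unfolding S_def I_def using x l
      by (intro sum.mono_neutral_right) (auto simp: less_le)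
    have ne: "I \<noteq> {}" using S SI by auto
    have L: "0 < L" unfolding L_def using fin ne by (intro sum_pos) (auto simp: I_def)
    have "(\<Sum>j\<in>I. (l j / L) *\<^sub>R x j) powr p \<le> (\<Sum>j\<in>I. (l j / L) * (x j powr p))"
      using fin ne powr_convex[of p] p1 L
      by (intro convex_on_sum[where C="{0<..}" and f="\<lambda>x. x powr p"])
        (auto simp: I_def sum_divide_distrib[symmetric] L_def)
    also have "(\<Sum>j\<in>I. (l j / L) *\<^sub>R x j) = S / L"
      by (simp add: SI sum_divide_distrib)
    also have "(\<Sum>j\<in>I. (l j / L) * (x j powr p)) = (\<Sum>j\<in>I. l j * x j powr p) / L"
      by (simp add: sum_divide_distrib)
    finally have "S powr p \<le> L powr p * ((\<Sum>j\<in>I. l j * x j powr p) / L)"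
      using S L by (simp add: powr_divide field_simps)
    also have "\<dots> = L powr (p - 1) * (\<Sum>j\<in>I. l j * x j powr p)"
      using L by (simp add: powr_diff)
    also have "\<dots> \<le> (\<Sum>j<N. l j) powr (p - 1) * (\<Sum>j<N. l j * x j powr p)"
      unfolding L_def using l x p1
      by (intro mult_mono powr_mono2 sum_mono2 sum_nonneg) (auto simp: I_def)
    finally show ?thesis using l by (simp add: e S_def)
  qed
qed

lemma powr_suminf_le:
  fixes x l :: "nat \<Rightarrow> real"
  assumes p: "0 < p" and x: "\<And>j. 0 \<le> x j" and l: "\<And>j. 0 \<le> l j"
  defines "e \<equiv> min p 1"
  assumes sl: "summable (\<lambda>j. l j powr e)" and sx: "summable (\<lambda>j. l j powr e * x j powr p)"
  shows "summable (\<lambda>j. l j * x j)"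
    and "(\<Sum>j. l j * x j) powr p
      \<le> (\<Sum>j. l j powr e) powr (p / e - 1) * (\<Sum>j. l j powr e * x j powr p)"
proof -
  define B where "B = (\<Sum>j. l j powr e) powr (p / e - 1) * (\<Sum>j. l j powr e * x j powr p)"
  have e: "0 < e" "1 \<le> p / e" using p by (auto simp: e_def min_def)
  have part: "(\<Sum>j<N. l j * x j) powr p \<le> B" for N
  proof -
    have "(\<Sum>j<N. l j * x j) powr p
      \<le> (\<Sum>j<N. l j powr e) powr (p / e - 1) * (\<Sum>j<N. l j powr e * x j powr p)"
      unfolding e_def using p x l by (rule sum_powr_le_powr_sum)
    also have "\<dots> \<le> B"
      unfolding B_def using sl sx e
      by (intro mult_mono powr_mono2 sum_le_suminf sum_nonneg) auto
    finally show ?thesis .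
  qed
  have nn: "0 \<le> (\<Sum>j<N. l j * x j)" for N using x l by (intro sum_nonneg) auto
  have "(\<Sum>j<N. l j * x j) \<le> B powr (1 / p)" for N
  proof -
    have "((\<Sum>j<N. l j * x j) powr p) powr (1 / p) \<le> B powr (1 / p)"
      using part p by (intro powr_mono2) auto
    then show ?thesis using p nn by (simp add: powr_powr)
  qed
  then show s: "summable (\<lambda>j. l j * x j)"
    using x l by (intro summableI_nonneg_bounded[where x="B powr (1 / p)"]) auto
  show "(\<Sum>j. l j * x j) powr p \<le> B"
  proof (rule LIMSEQ_le_const2)
    have "(\<lambda>N. \<Sum>j<N. l j * x j) \<longlonglongrightarrow> (\<Sum>j. l j * x j)"
      using s by (simp add: summable_LIMSEQ)
    then show "(\<lambda>N. (\<Sum>j<N. l j * x j) powr p) \<longlonglongrightarrow> (\<Sum>j. l j * x j) powr p"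
      using p nn by (intro tendsto_powr2) (auto simp: )
  qed (use part in auto)
qed

lemma Lp_series:
  fixes lam :: "nat \<Rightarrow> real" and u :: "nat \<Rightarrow> 'a \<Rightarrow> real"
  assumes p: "0 < p" and A: "0 \<le> A"
    and u [measurable]: "\<And>j. u j \<in> borel_measurable M"
    and bd: "\<And>j. (\<integral>\<^sup>+x. ennreal (\<bar>u j x\<bar> powr p) \<partial>M) \<le> ennreal A"
    and sl: "summable (\<lambda>j. \<bar>lam j\<bar> powr min p 1)"
  shows "AE x in M. summable (\<lambda>j. \<bar>lam j\<bar> * \<bar>u j x\<bar>)"
    and "(\<integral>\<^sup>+x. ennreal ((\<Sum>j. \<bar>lam j\<bar> * \<bar>u j x\<bar>) powr p) \<partial>M)
      \<le> ennreal (A * (\<Sum>j. \<bar>lam j\<bar> powr min p 1) powr (p / min p 1))"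
proof -
  define e where "e = min p 1"
  have e: "0 < e" "1 \<le> p / e" using p by (auto simp: e_def min_def)
  define \<Lambda> where "\<Lambda> = (\<Sum>j. \<bar>lam j\<bar> powr e)"
  have \<Lambda>: "0 \<le> \<Lambda>" unfolding \<Lambda>_def using sl by (intro suminf_nonneg) (auto simp: e_def)
  have "(\<integral>\<^sup>+x. (\<Sum>j. ennreal (\<bar>lam j\<bar> powr e * \<bar>u j x\<bar> powr p)) \<partial>M)
      = (\<Sum>j. \<integral>\<^sup>+x. ennreal (\<bar>lam j\<bar> powr e * \<bar>u j x\<bar> powr p) \<partial>M)"
    by (intro nn_integral_suminf) measurable
  also have "\<dots> \<le> (\<Sum>j. ennreal (\<bar>lam j\<bar> powr e * A))"
  proof (intro suminf_le allI)
    fix j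
    have "(\<integral>\<^sup>+x. ennreal (\<bar>lam j\<bar> powr e * \<bar>u j x\<bar> powr p) \<partial>M)
      = ennreal (\<bar>lam j\<bar> powr e) * (\<integral>\<^sup>+x. ennreal (\<bar>u j x\<bar> powr p) \<partial>M)"
      by (simp add: ennreal_mult nn_integral_cmult)
    also have "\<dots> \<le> ennreal (\<bar>lam j\<bar> powr e) * ennreal A" by (intro mult_left_mono bd) auto
    finally show "(\<integral>\<^sup>+x. ennreal (\<bar>lam j\<bar> powr e * \<bar>u j x\<bar> powr p) \<partial>M) \<le> ennreal (\<bar>lam j\<bar> powr e * A)"
      using A by (simp add: ennreal_mult)
  qed auto
  also have "\<dots> = ennreal (\<Lambda> * A)"
    unfolding \<Lambda>_def using sl A
    by (subst suminf_ennreal2) (auto simp: e_def suminf_mult2 intro: summable_mult2)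
  finally have int: "(\<integral>\<^sup>+x. (\<Sum>j. ennreal (\<bar>lam j\<bar> powr e * \<bar>u j x\<bar> powr p)) \<partial>M) \<le> ennreal (\<Lambda> * A)" .
  have "AE x in M. (\<Sum>j. ennreal (\<bar>lam j\<bar> powr e * \<bar>u j x\<bar> powr p)) \<noteq> \<infinity>"
    using int by (intro nn_integral_PInf_AE) (auto simp: top_unique)
  then have ae: "AE x in M. summable (\<lambda>j. \<bar>lam j\<bar> powr e * \<bar>u j x\<bar> powr p)"
    by eventually_elim (intro summable_suminf_not_top, auto)
  then show "AE x in M. summable (\<lambda>j. \<bar>lam j\<bar> * \<bar>u j x\<bar>)"
    by eventually_elim (rule powr_suminf_le(1)[OF p], use sl in \<open>auto simp: e_def\<close>)
  have "AE x in M. ennreal ((\<Sum>j. \<bar>lam j\<bar> * \<bar>u j x\<bar>) powr p)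
      \<le> ennreal (\<Lambda> powr (p / e - 1)) * (\<Sum>j. ennreal (\<bar>lam j\<bar> powr e * \<bar>u j x\<bar> powr p))"
    using ae
  proof eventually_elim
    case (elim x)
    have "(\<Sum>j. \<bar>lam j\<bar> * \<bar>u j x\<bar>) powr p \<le> \<Lambda> powr (p / e - 1) * (\<Sum>j. \<bar>lam j\<bar> powr e * \<bar>u j x\<bar> powr p)"
      unfolding \<Lambda>_def e_def by (rule powr_suminf_le(2)[OF p]) (use sl elim in \<open>auto simp: e_def\<close>)
    then have "ennreal ((\<Sum>j. \<bar>lam j\<bar> * \<bar>u j x\<bar>) powr p)
      \<le> ennreal (\<Lambda> powr (p / e - 1) * (\<Sum>j. \<bar>lam j\<bar> powr e * \<bar>u j x\<bar> powr p))"
      by (rule ennreal_leI)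
    also have "\<dots> = ennreal (\<Lambda> powr (p / e - 1)) * (\<Sum>j. ennreal (\<bar>lam j\<bar> powr e * \<bar>u j x\<bar> powr p))"
      using elim by (subst suminf_ennreal2) (auto simp: ennreal_mult suminf_nonneg)
    finally show ?case .
  qed
  then have "(\<integral>\<^sup>+x. ennreal ((\<Sum>j. \<bar>lam j\<bar> * \<bar>u j x\<bar>) powr p) \<partial>M)
     \<le> (\<integral>\<^sup>+x. ennreal (\<Lambda> powr (p / e - 1)) * (\<Sum>j. ennreal (\<bar>lam j\<bar> powr e * \<bar>u j x\<bar> powr p)) \<partial>M)"
    by (rule nn_integral_mono_AE)
  also have "\<dots> = ennreal (\<Lambda> powr (p / e - 1)) * (\<integral>\<^sup>+x. (\<Sum>j. ennreal (\<bar>lam j\<bar> powr e * \<bar>u j x\<bar> powr p)) \<partial>M)"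
    by (intro nn_integral_cmult) measurable
  also have "\<dots> \<le> ennreal (\<Lambda> powr (p / e - 1)) * ennreal (\<Lambda> * A)"
    using int by (intro mult_left_mono) auto
  also have "\<dots> = ennreal (A * (\<Lambda> * \<Lambda> powr (p / e - 1)))"
    using \<Lambda> A by (simp add: ennreal_mult[symmetric] algebra_simps)
  also have "\<Lambda> * \<Lambda> powr (p / e - 1) = \<Lambda> powr (p / e)"
    using \<Lambda> by (cases "\<Lambda> = 0") (auto simp: powr_mult_base)
  finally show "(\<integral>\<^sup>+x. ennreal ((\<Sum>j. \<bar>lam j\<bar> * \<bar>u j x\<bar>) powr p) \<partial>M)
      \<le> ennreal (A * (\<Sum>j. \<bar>lam j\<bar> powr min p 1) powr (p / min p 1))"
    by (simp add: \<Lambda>_def e_def)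
qed

section \<open>The image of a block\<close>

text \<open>A block with a chosen cube, for weights with \<open>w(Q) > 0\<close>: the bound is then a real number.\<close>

definition block_on ::
  "real \<Rightarrow> ennreal \<Rightarrow> (real ^ 'n \<Rightarrow> real) \<Rightarrow> real ^ 'n \<Rightarrow> real \<Rightarrow> (real ^ 'n \<Rightarrow> real) \<Rightarrow> bool" where
  "block_on p s w c l h \<longleftrightarrow> h \<in> Lspace lebesgue s \<and> 0 < l \<and> closure {x. h x \<noteq> 0} \<subseteq> cube c l \<and>
     Lnorm lebesgue s h \<le> ennreal (measure lebesgue (cube c l) powr enn2real (inverse s)
                             * measure (wm w) (cube c l) powr (- 1 / p))"

lemma block_iff_block_on:
  assumes pos: "\<And>c l. 0 < l \<Longrightarrow> 0 < measure (wm w) (cube c l)"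
  shows "block p s w h \<longleftrightarrow> (\<exists>c l. block_on p s w c l h)"
proof -
  have "ennreal (measure lebesgue (cube c l) powr enn2real (inverse s))
        * inverse (ennreal (measure (wm w) (cube c l) powr (1 / p)))
    = ennreal (measure lebesgue (cube c l) powr enn2real (inverse s)
        * measure (wm w) (cube c l) powr (- 1 / p))" if "0 < l" for c l
  proof -
    have "0 < measure (wm w) (cube c l) powr (1 / p)"
      using pos[OF that, of c] by simp
    then show ?thesis by (simp add: inverse_ennreal ennreal_mult[symmetric] powr_minus)
  qed
  then show ?thesis
    unfolding block_def block_on_def by (metis (no_types, lifting))
qed

lemma eq_0_outside_cube: "closure {x. h x \<noteq> 0} \<subseteq> cube c l \<Longrightarrow> x \<notin> cube c l \<Longrightarrow> h x = 0"
  using closure_subset[of "{x. h x \<noteq> 0}"] by auto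

lemma block_on_Lp:
  fixes w :: "real ^ 'n \<Rightarrow> real"
  assumes "block_on p (ennreal \<sigma>) w c l h" "1 \<le> \<sigma>"
  shows "(\<integral>\<^sup>+x. ennreal (\<bar>h x\<bar> powr \<sigma>) \<partial>lebesgue)
    \<le> ennreal (l ^ CARD('n) * (measure (wm w) (cube c l) powr (- 1 / p)) powr \<sigma>)"
proof -
  have l: "0 < l" using assms by (simp add: block_on_def)
  have e: "enn2real (inverse (ennreal \<sigma>)) = 1 / \<sigma>"
    using assms(2) by (simp add: inverse_ennreal inverse_eq_divide)
  have "(\<integral>\<^sup>+x. ennreal (\<bar>h x\<bar> powr \<sigma>) \<partial>lebesgue)
    \<le> ennreal (((l ^ CARD('n)) powr (1 / \<sigma>) * measure (wm w) (cube c l) powr (- 1 / p)) powr \<sigma>)"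
    using assms l by (subst Lnorm_le_iff[symmetric]) (auto simp: block_on_def e measure_cube)
  also have "((l ^ CARD('n)) powr (1 / \<sigma>) * measure (wm w) (cube c l) powr (- 1 / p)) powr \<sigma>
    = l ^ CARD('n) * (measure (wm w) (cube c l) powr (- 1 / p)) powr \<sigma>"
    using assms(2) l by (simp add: powr_mult powr_powr)
  finally show ?thesis .
qed

lemma block_on_bounded:
  assumes "block_on p top w c l h"
  shows "AE x in lebesgue. \<bar>h x\<bar> \<le> measure (wm w) (cube c l) powr (- 1 / p)"
proof (rule AE_le_Lnorm_top)
  have "0 < measure lebesgue (cube c l)" using assms by (simp add: block_on_def measure_cube)
  then show "Lnorm lebesgue top h \<le> ennreal (measure (wm w) (cube c l) powr (- 1 / p))"
    using assms by (simp add: block_on_def)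
qed auto

lemma le_1_plus_powr: "1 \<le> s \<Longrightarrow> 0 \<le> y \<Longrightarrow> y \<le> 1 + y powr s" for y s :: real
proof (cases "y \<le> 1")
  case False
  assume "1 \<le> s"
  then have "y powr 1 \<le> y powr s" using False by (intro powr_mono) auto
  then show ?thesis using False by simp
qed (auto intro: add_increasing2)

text \<open>The classical bound \<open>\<parallel>h\<parallel>\<^sub>1 \<le> |Q|^(1-1/s) \<parallel>h\<parallel>\<^sub>s\<close> is Hoelder's inequality. Up to the factor 2 it follows
  from \<open>y \<le> 1 + y^s\<close>, applied to \<open>y = |h| / \<mu>\<close> with \<open>\<mu> = w(Q)^(-1/p)\<close> and integrated over \<open>Q\<close>.\<close>

lemma block_on_L1:
  fixes w :: "real ^ 'n \<Rightarrow> real"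
  assumes h: "block_on p s w c l h" and s: "1 \<le> s" and pos: "0 < measure (wm w) (cube c l)"
  shows "Lnorm lebesgue 1 h \<le> ennreal (2 * l ^ CARD('n) * measure (wm w) (cube c l) powr (- 1 / p))"
proof -
  define \<mu> where "\<mu> = measure (wm w) (cube c l) powr (- 1 / p)"
  have \<mu>: "0 < \<mu>" using pos by (simp add: \<mu>_def)
  have l: "0 < l" using h by (simp add: block_on_def)
  have [measurable]: "h \<in> borel_measurable lebesgue" using h by (auto simp: block_on_def Lspace_def)
  have out: "x \<notin> cube c l \<Longrightarrow> h x = 0" for x
    using h by (auto simp: block_on_def intro: eq_0_outside_cube)
  have cubeint: "(\<integral>\<^sup>+x. ennreal \<mu> * indicator (cube c l) x \<partial>lebesgue) = ennreal (\<mu> * l ^ CARD('n))"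
    using l \<mu> by (simp add: nn_integral_cmult emeasure_cube ennreal_mult)
  from s show ?thesis
  proof (cases rule: exponent_cases)
    case top
    have "AE x in lebesgue. ennreal \<bar>h x\<bar> \<le> ennreal \<mu> * indicator (cube c l) x"
      using block_on_bounded[OF h[unfolded top]]
      by eventually_elim (auto simp: out \<mu>_def ennreal_leI split: split_indicator)
    then have "Lnorm lebesgue 1 h \<le> ennreal (\<mu> * l ^ CARD('n))"
      unfolding Lnorm_one cubeint[symmetric] by (rule nn_integral_mono_AE)
    also have "\<dots> \<le> ennreal (2 * l ^ CARD('n) * \<mu>)"
      using \<mu> l by (intro ennreal_leI) simp
    finally show ?thesis by (simp add: \<mu>_def)
  next
    case (real \<sigma>)
    have I: "(\<integral>\<^sup>+x. ennreal (\<bar>h x\<bar> powr \<sigma>) \<partial>lebesgue) \<le> ennreal (l ^ CARD('n) * \<mu> powr \<sigma>)"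
      using block_on_Lp[of p \<sigma> w c l h] h real by (simp add: \<mu>_def)
    have pt: "ennreal \<bar>h x\<bar> \<le> ennreal \<mu> * indicator (cube c l) x + ennreal (\<mu> / \<mu> powr \<sigma>) * ennreal (\<bar>h x\<bar> powr \<sigma>)" for x
    proof (cases "x \<in> cube c l")
      case True
      have "\<bar>h x\<bar> / \<mu> \<le> 1 + (\<bar>h x\<bar> / \<mu>) powr \<sigma>" using real \<mu> by (intro le_1_plus_powr) auto
      then have "\<bar>h x\<bar> \<le> \<mu> + \<mu> / \<mu> powr \<sigma> * \<bar>h x\<bar> powr \<sigma>"
        using \<mu> by (simp add: powr_divide field_simps)
      then show ?thesis using True \<mu>
        by (simp add: ennreal_mult[symmetric] ennreal_plus[symmetric] ennreal_leI del: ennreal_plus)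
    qed (simp add: out)
    have "Lnorm lebesgue 1 h \<le> (\<integral>\<^sup>+x. ennreal \<mu> * indicator (cube c l) x
        + ennreal (\<mu> / \<mu> powr \<sigma>) * ennreal (\<bar>h x\<bar> powr \<sigma>) \<partial>lebesgue)"
      unfolding Lnorm_one by (rule nn_integral_mono) (rule pt)
    also have "\<dots> = ennreal (\<mu> * l ^ CARD('n)) + ennreal (\<mu> / \<mu> powr \<sigma>) * (\<integral>\<^sup>+x. ennreal (\<bar>h x\<bar> powr \<sigma>) \<partial>lebesgue)"
      unfolding cubeint[symmetric] by (subst nn_integral_add) (auto simp: nn_integral_cmult)
    also have "\<dots> \<le> ennreal (\<mu> * l ^ CARD('n)) + ennreal (\<mu> / \<mu> powr \<sigma>) * ennreal (l ^ CARD('n) * \<mu> powr \<sigma>)"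
      using I by (intro add_left_mono mult_left_mono) auto
    also have "\<dots> = ennreal (2 * l ^ CARD('n) * \<mu>)"
      using \<mu> l by (simp add: ennreal_mult[symmetric] ennreal_plus[symmetric] del: ennreal_plus)
    finally show ?thesis by (simp add: \<mu>_def)
  qed
qed

lemma card_ge_1: "1 \<le> real CARD('n::finite)"
  using zero_less_card_finite[where 'a='n] by linarith

lemma two_sqrt_card_gt_1: "1 < 2 * sqrt (real CARD('n::finite))"
proof -
  have "1 \<le> sqrt (real CARD('n))" using card_ge_1[where 'n='n] by simp
  then show ?thesis by linarith
qed

lemma D_classD:
  fixes w :: "real ^ 'n \<Rightarrow> real"
  assumes "D_class q w"
  obtains D where "0 \<le> D" "\<And>c l t. 0 < l \<Longrightarrow> 1 < t \<Longrightarrow>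
     measure (wm w) (cube c (t * l)) \<le> D * t powr (real CARD('n) * q) * measure (wm w) (cube c l)"
proof -
  obtain D where D: "\<And>c l t. 0 < l \<Longrightarrow> 1 < t \<Longrightarrow>
     measure (wm w) (cube c (t * l)) \<le> D * t powr (real CARD('n) * q) * measure (wm w) (cube c l)"
    using assms by (auto simp: D_class_def)
  have "measure (wm w) (cube c (t * l)) \<le> max D 0 * t powr (real CARD('n) * q) * measure (wm w) (cube c l)"
    if "0 < l" "1 < t" for c l t
    by (rule order_trans[OF D[OF that]]) (intro mult_right_mono, auto)
  then show ?thesis by (intro that[of "max D 0"]) auto
qed

lemma RH_classD:
  fixes w :: "real ^ 'n \<Rightarrow> real"
  assumes w: "weight w" and RH: "RH_class r w" and r: "1 < r"
  obtains R where "0 \<le> R" "\<And>c l. 0 < l \<Longrightarrow>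
    (\<integral>\<^sup>+x\<in>cube c l. ennreal (w x powr r) \<partial>lebesgue)
      \<le> ennreal (l ^ CARD('n) * (R * measure (wm w) (cube c l) / l ^ CARD('n)) powr r)"
proof -
  obtain R where R: "\<And>c l. 0 < l \<Longrightarrow>
     set_integrable lebesgue (cube c l) (\<lambda>x. w x powr r) \<and>
     (1 / measure lebesgue (cube c l) * (LINT x:cube c l|lebesgue. w x powr r)) powr (1 / r)
       \<le> R / measure lebesgue (cube c l) * (LINT x:cube c l|lebesgue. w x)"
    using RH by (auto simp: RH_class_def)
  show ?thesis
  proof (rule that[of "max R 0"])
    fix c :: "real ^ 'n" and l :: real
    assume l: "0 < l"
    define v where "v = l ^ CARD('n)"
    define m where "m = measure (wm w) (cube c l)"
    define I where "I = (LINT x:cube c l|lebesgue. w x powr r)"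
    have v: "0 < v" using l by (simp add: v_def)
    have I: "0 \<le> I" unfolding I_def set_lebesgue_integral_def by (intro integral_nonneg_AE) auto
    have si: "set_integrable lebesgue (cube c l) (\<lambda>x. w x powr r)" using R[OF l] by blast
    have "(I / v) powr (1 / r) \<le> R / v * m"
      using R[OF l, of c] unfolding measure_cube[OF l] emeasure_wm_cube(4)[OF w, symmetric]
      by (simp add: I_def v_def m_def)
    also have "\<dots> \<le> max R 0 * m / v"
      using v by (simp add: m_def divide_right_mono mult_right_mono)
    finally have "((I / v) powr (1 / r)) powr r \<le> (max R 0 * m / v) powr r"
      using r by (intro powr_mono2) auto
    then have "I \<le> v * (max R 0 * m / v) powr r"
      using r v I by (simp add: powr_powr field_simps)
    moreover have "(\<integral>\<^sup>+x\<in>cube c l. ennreal (w x powr r) \<partial>lebesgue) = ennreal I"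
    proof -
      have "(\<integral>\<^sup>+x\<in>cube c l. ennreal (w x powr r) \<partial>lebesgue)
        = (\<integral>\<^sup>+x. ennreal (indicator (cube c l) x *\<^sub>R w x powr r) \<partial>lebesgue)"
        by (intro nn_integral_cong) (auto split: split_indicator)
      also have "\<dots> = ennreal I"
        unfolding I_def set_lebesgue_integral_def
        using si by (intro nn_integral_eq_integral) (auto simp: set_integrable_def)
      finally show ?thesis .
    qed
    ultimately show "(\<integral>\<^sup>+x\<in>cube c l. ennreal (w x powr r) \<partial>lebesgue)
      \<le> ennreal (l ^ CARD('n) * (max R 0 * measure (wm w) (cube c l) / l ^ CARD('n)) powr r)"
      by (simp add: v_def m_def ennreal_leI)
  qed auto
qed

lemma block_estimates_nonneg:
  assumes "block_estimates p s w C T"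
  shows "block_estimates p s w (max C 0) T"
proof -
  have "ennreal (max C 0) = ennreal C" by (simp add: max_def ennreal_neg)
  then show ?thesis using assms unfolding block_estimates_def by simp
qed

lemma image_Lnorm_le:
  fixes w :: "real ^ 'n \<Rightarrow> real"
  assumes est: "block_estimates p s w C T" and C: "0 \<le> C" and s: "1 \<le> s"
    and h: "block p s w h" and l: "0 < l" and sub: "closure {x. h x \<noteq> 0} \<subseteq> cube c l"
    and b: "Lnorm lebesgue s h \<le> ennreal b" "0 \<le> b"
  shows "Lnorm (lebesgue_on (cube c (2 * sqrt (real CARD('n)) * l))) s (T h) \<le> ennreal (C * b)"
proof -
  have hs: "h \<in> borel_measurable lebesgue" using h by (auto simp: block_def Lspace_def)
  have s0: "0 < s" using s by (metis ennreal_zero_less_one less_le_trans)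
  have "Lnorm (lebesgue_on (cube c (2 * sqrt (real CARD('n)) * l))) s (T h)
      \<le> ennreal C * Lnorm (lebesgue_on (cube c l)) s h"
    using est h l sub unfolding block_estimates_def by blast
  also have "\<dots> \<le> ennreal C * ennreal b"
    using Lnorm_restrict_le[OF s0 hs, of "cube c l"] b by (intro mult_left_mono) auto
  finally show ?thesis using C b by (simp add: ennreal_mult)
qed

lemma powr_minus_inverse_exponent:
  fixes m p :: real
  assumes "0 < p" "0 < m"
  shows "(m powr (- 1 / p)) powr p = 1 / m" "(m powr - (1 / p)) powr p = 1 / m"
proof -
  have "(m powr (- 1 / p)) powr p = m powr (- 1)" using assms(1) by (simp only: powr_powr) simp
  then show "(m powr (- 1 / p)) powr p = 1 / m" using assms(2) by (simp add: powr_minus_divide)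
  then show "(m powr - (1 / p)) powr p = 1 / m" by simp
qed

text \<open>Here \<open>|T h| \<le> C w(Q)^(-1/p)\<close> on \<open>Q' = 2 n^(1/2) Q\<close>, and \<open>w(Q') \<le> C w(Q)\<close> by doubling.\<close>

lemma image_on_cube_bounded:
  fixes w :: "real ^ 'n \<Rightarrow> real"
  assumes p: "0 < p" and w: "weight w" and D: "D_class q w"
    and pos: "\<And>c l. 0 < l \<Longrightarrow> 0 < measure (wm w) (cube c l)"
    and est: "block_estimates p top w C T" and C: "0 \<le> C"
    and T_meas: "\<And>h. block p top w h \<Longrightarrow> T h \<in> borel_measurable lebesgue"
  shows "\<exists>K\<ge>0. \<forall>h c l. block_on p top w c l h \<longrightarrow>
    (\<integral>\<^sup>+x\<in>cube c (2 * sqrt (real CARD('n)) * l). ennreal (\<bar>T h x\<bar> powr p) \<partial>wm w) \<le> ennreal K"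
proof -
  let ?d = "2 * sqrt (real CARD('n))"
  obtain D where D0: "0 \<le> D" and D: "\<And>c l t. 0 < l \<Longrightarrow> 1 < t \<Longrightarrow>
     measure (wm w) (cube c (t * l)) \<le> D * t powr (real CARD('n) * q) * measure (wm w) (cube c l)"
    using D_classD[OF D] by blast
  show ?thesis
  proof (intro exI[of _ "C powr p * (D * ?d powr (real CARD('n) * q))"] conjI allI impI)
    show "0 \<le> C powr p * (D * ?d powr (real CARD('n) * q))" using D0 by simp
    fix h c l assume hb: "block_on p top w c l h"
    then have l: "0 < l" and sub: "closure {x. h x \<noteq> 0} \<subseteq> cube c l" by (auto simp: block_on_def)
    have h: "block p top w h" using hb block_iff_block_on[OF pos] by blast
    note [measurable] = T_meas[OF h]
    define m where "m = measure (wm w) (cube c l)"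
    have m: "0 < m" using pos l by (simp add: m_def)
    have vol: "0 < measure lebesgue (cube c l)" using l by (simp add: measure_cube)
    have "Lnorm (lebesgue_on (cube c (?d * l))) top (T h) \<le> ennreal (C * m powr (- 1 / p))"
      using hb vol by (intro image_Lnorm_le[OF est C _ h l sub]) (auto simp: block_on_def m_def)
    then have "AE x in lebesgue_on (cube c (?d * l)). \<bar>T h x\<bar> \<le> C * m powr (- 1 / p)"
      using C by (intro AE_le_Lnorm_top) auto
    then have "AE x in lebesgue. x \<in> cube c (?d * l) \<longrightarrow> \<bar>T h x\<bar> \<le> C * m powr (- 1 / p)"
      by (subst (asm) AE_restrict_space_iff) auto
    then have "AE x in wm w. x \<in> cube c (?d * l) \<longrightarrow> \<bar>T h x\<bar> \<le> C * m powr (- 1 / p)"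
      by (rule AE_wm_if_lebesgue[OF w])
    then have "AE x in wm w. ennreal (\<bar>T h x\<bar> powr p) * indicator (cube c (?d * l)) x
        \<le> ennreal ((C * m powr (- 1 / p)) powr p) * indicator (cube c (?d * l)) x"
      by eventually_elim (use p in \<open>auto intro!: ennreal_leI powr_mono2 split: split_indicator\<close>)
    then have "(\<integral>\<^sup>+x\<in>cube c (?d * l). ennreal (\<bar>T h x\<bar> powr p) \<partial>wm w)
        \<le> (\<integral>\<^sup>+x. ennreal ((C * m powr (- 1 / p)) powr p) * indicator (cube c (?d * l)) x \<partial>wm w)"
      by (rule nn_integral_mono_AE)
    also have "\<dots> = ennreal ((C * m powr (- 1 / p)) powr p * measure (wm w) (cube c (?d * l)))"
      by (simp add: nn_integral_cmult emeasure_wm_cube(3)[OF w] ennreal_mult)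
    also have "\<dots> \<le> ennreal ((C * m powr (- 1 / p)) powr p * (D * ?d powr (real CARD('n) * q) * m))"
      unfolding m_def using l two_sqrt_card_gt_1[where 'n='n]
      by (intro ennreal_leI mult_left_mono D) auto
    also have "(C * m powr (- 1 / p)) powr p = C powr p / m"
      using C by (simp only: powr_mult powr_minus_inverse_exponent[OF p m]) simp
    also have "C powr p / m * (D * ?d powr (real CARD('n) * q) * m) = C powr p * (D * ?d powr (real CARD('n) * q))"
      using m by simp
    finally show "(\<integral>\<^sup>+x\<in>cube c (?d * l). ennreal (\<bar>T h x\<bar> powr p) \<partial>wm w)
       \<le> ennreal (C powr p * (D * ?d powr (real CARD('n) * q)))" .
  qed
qed

text \<open>A crude form of Young's inequality; it takes the place of Hoelder's inequality with the three
  exponents \<open>1/a\<close>, \<open>1/b\<close> and \<open>1/(1-a-b)\<close>.\<close>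

lemma powr_mult_powr_le:
  fixes X Y :: real
  assumes "0 \<le> X" "0 \<le> Y" "0 \<le> a" "0 \<le> b" "a + b \<le> 1"
  shows "X powr a * Y powr b \<le> X + Y + 1"
proof -
  define Z where "Z = max 1 (max X Y)"
  have "X powr a * Y powr b \<le> Z powr a * Z powr b"
    using assms by (intro mult_mono powr_mono2) (auto simp: Z_def)
  also have "\<dots> = Z powr (a + b)" by (simp add: powr_add)
  also have "\<dots> \<le> Z powr 1" using assms by (intro powr_mono) (auto simp: Z_def)
  also have "\<dots> \<le> X + Y + 1" using assms by (auto simp: Z_def)
  finally show ?thesis .
qed

text \<open>Write \<open>m = w(Q)\<close>, \<open>v = |Q|\<close>, and normalise the two factors of \<open>|T h|^p w\<close>: the functions
  \<open>X = |T h|^\<sigma> m^(\<sigma>/p)\<close> and \<open>Y = (w v / m)^r\<close> have averages over \<open>2 n^(1/2) Q\<close> that are bounded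
  by constants, \<open>X\<close> because of the bound of \<open>T\<close> in \<open>L^\<sigma>\<close> and \<open>Y\<close> because of the reverse Hoelder
  inequality and doubling. Now \<open>|T h|^p w = X^(p/\<sigma>) Y^(1/r) / v\<close>, and the condition
  \<open>r p / (r - 1) \<le> \<sigma>\<close> says that \<open>p/\<sigma> + 1/r \<le> 1\<close>, so that \<open>(X + Y + 1) / v\<close> is an upper bound.\<close>

lemma image_on_cube_reverse_Hoelder:
  fixes w :: "real ^ 'n \<Rightarrow> real"
  assumes p: "0 < p" and w: "weight w" and D: "D_class q w" and RH: "RH_class r w" and r: "1 < r"
    and \<sigma>: "1 \<le> \<sigma>" "r * p / (r - 1) \<le> \<sigma>"
    and pos: "\<And>c l. 0 < l \<Longrightarrow> 0 < measure (wm w) (cube c l)"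
    and est: "block_estimates p (ennreal \<sigma>) w C T" and C: "0 \<le> C"
    and T_meas: "\<And>h. block p (ennreal \<sigma>) w h \<Longrightarrow> T h \<in> borel_measurable lebesgue"
  shows "\<exists>K\<ge>0. \<forall>h c l. block_on p (ennreal \<sigma>) w c l h \<longrightarrow>
    (\<integral>\<^sup>+x\<in>cube c (2 * sqrt (real CARD('n)) * l). ennreal (\<bar>T h x\<bar> powr p) \<partial>wm w) \<le> ennreal K"
proof -
  let ?d = "2 * sqrt (real CARD('n))"
  let ?n = "CARD('n)"
  note [measurable] = weight_measurable[OF w]
  have wnn: "0 \<le> w x" for x using w by (simp add: weight_def)
  have exps: "p / \<sigma> + 1 / r \<le> 1"
  proof -
    have "r * p \<le> \<sigma> * (r - 1)" using \<sigma>(2) r by (simp add: field_simps)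
    then show ?thesis using \<sigma>(1) r by (simp add: field_simps)
  qed
  obtain D where D0: "0 \<le> D" and D: "\<And>c l t. 0 < l \<Longrightarrow> 1 < t \<Longrightarrow>
     measure (wm w) (cube c (t * l)) \<le> D * t powr (real CARD('n) * q) * measure (wm w) (cube c l)"
    using D_classD[OF D] by blast
  obtain R where R0: "0 \<le> R" and R: "\<And>c l. 0 < l \<Longrightarrow>
    (\<integral>\<^sup>+x\<in>cube c l. ennreal (w x powr r) \<partial>lebesgue)
      \<le> ennreal (l ^ CARD('n) * (R * measure (wm w) (cube c l) / l ^ CARD('n)) powr r)"
    using RH_classD[OF w RH r] by blast
  \<comment> \<open>\<open>G m / v\<close> bounds \<open>R\<close> times the average of \<open>w\<close> over the dilated cube.\<close>
  define G where "G = R * (D * ?d powr (real CARD('n) * q)) / ?d ^ ?n"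
  have d: "1 < ?d" by (rule two_sqrt_card_gt_1)
  have G0: "0 \<le> G" using R0 D0 d by (simp add: G_def)
  define K where "K = C powr \<sigma> + ?d ^ ?n * G powr r + ?d ^ ?n"
  show ?thesis
  proof (intro exI[of _ K] conjI allI impI)
    show "0 \<le> K" using d by (simp add: K_def)
    fix h c l assume hb: "block_on p (ennreal \<sigma>) w c l h"
    then have l: "0 < l" and sub: "closure {x. h x \<noteq> 0} \<subseteq> cube c l" by (auto simp: block_on_def)
    have h: "block p (ennreal \<sigma>) w h" using hb block_iff_block_on[OF pos] by blast
    note [measurable] = T_meas[OF h]
    let ?Q = "cube c (?d * l)"
    define m where "m = measure (wm w) (cube c l)"
    have m: "0 < m" using pos l by (simp add: m_def)
    define v where "v = l ^ ?n"
    have v: "0 < v" using l by (simp add: v_def)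
    have dl: "0 < ?d * l" using d l by simp
    have vd: "(?d * l) ^ ?n = ?d ^ ?n * v" by (simp add: v_def power_mult_distrib)
    have e: "enn2real (inverse (ennreal \<sigma>)) = 1 / \<sigma>"
      using \<sigma> by (simp add: inverse_ennreal inverse_eq_divide)
    have "Lnorm (lebesgue_on ?Q) (ennreal \<sigma>) (T h) \<le> ennreal (C * (v powr (1 / \<sigma>) * m powr (- 1 / p)))"
      using hb \<sigma> l by (intro image_Lnorm_le[OF est C _ h l sub]) (auto simp: block_on_def m_def v_def measure_cube e)
    then have "(\<integral>\<^sup>+x. ennreal (\<bar>T h x\<bar> powr \<sigma>) \<partial>lebesgue_on ?Q)
        \<le> ennreal ((C * (v powr (1 / \<sigma>) * m powr (- 1 / p))) powr \<sigma>)"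
      using \<sigma> C by (subst (asm) Lnorm_le_iff) auto
    also have "(C * (v powr (1 / \<sigma>) * m powr (- 1 / p))) powr \<sigma> = C powr \<sigma> * v / m powr (\<sigma> / p)"
    proof -
      have "(m powr (- 1 / p)) powr \<sigma> = m powr (- (\<sigma> / p))"
        by (simp only: powr_powr) simp
      then have "(m powr (- 1 / p)) powr \<sigma> = 1 / m powr (\<sigma> / p)"
        by (simp only: powr_minus_divide)
      then show ?thesis using \<sigma> C v by (simp add: powr_mult powr_powr)
    qed
    finally have IX: "(\<integral>\<^sup>+x\<in>?Q. ennreal (\<bar>T h x\<bar> powr \<sigma>) \<partial>lebesgue) \<le> ennreal (C powr \<sigma> * v / m powr (\<sigma> / p))"
      by (subst (asm) nn_integral_restrict_space) auto
    have IY: "(\<integral>\<^sup>+x\<in>?Q. ennreal (w x powr r) \<partial>lebesgue) \<le> ennreal (?d ^ ?n * v * (G * m / v) powr r)"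
    proof -
      have "R * measure (wm w) ?Q / (?d * l) ^ ?n \<le> R * (D * ?d powr (real CARD('n) * q) * m) / (?d * l) ^ ?n"
        unfolding m_def using R0 dl l d by (intro divide_right_mono mult_left_mono D) auto
      also have "\<dots> = G * m / v" by (simp add: vd G_def)
      finally have "(R * measure (wm w) ?Q / (?d * l) ^ ?n) powr r \<le> (G * m / v) powr r"
        using R0 dl r by (intro powr_mono2) auto
      then have "ennreal ((?d * l) ^ ?n * (R * measure (wm w) ?Q / (?d * l) ^ ?n) powr r)
        \<le> ennreal ((?d * l) ^ ?n * (G * m / v) powr r)"
        using dl by (intro ennreal_leI mult_left_mono) auto
      with R[OF dl, of c] show ?thesis unfolding vd by (rule order_trans)
    qed
    have pt: "w x * \<bar>T h x\<bar> powr p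
        \<le> (m powr (\<sigma> / p) / v) * \<bar>T h x\<bar> powr \<sigma> + ((v / m) powr r / v) * w x powr r + 1 / v" for x
    proof -
      define X where "X = \<bar>T h x\<bar> powr \<sigma> * m powr (\<sigma> / p)"
      define Y where "Y = (w x * v / m) powr r"
      have "X powr (p / \<sigma>) = \<bar>T h x\<bar> powr p * m"
        using \<sigma> p m by (simp add: X_def powr_mult powr_powr)
      moreover have "Y powr (1 / r) = w x * v / m"
        using r v m wnn[of x] by (simp add: Y_def powr_powr)
      moreover have "X powr (p / \<sigma>) * Y powr (1 / r) \<le> X + Y + 1"
        using exps p \<sigma> r by (intro powr_mult_powr_le) (auto simp: X_def Y_def)
      ultimately have "(\<bar>T h x\<bar> powr p * m) * (w x * v / m) \<le> X + Y + 1" by simp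
      then have "w x * \<bar>T h x\<bar> powr p * v \<le> X + Y + 1" using m by (simp add: mult_ac)
      moreover have "Y = (v / m) powr r * w x powr r"
        using v m wnn[of x] by (simp add: Y_def powr_mult[symmetric] field_simps)
      ultimately show ?thesis using v by (simp add: X_def field_simps)
    qed
    have "(\<integral>\<^sup>+x\<in>?Q. ennreal (\<bar>T h x\<bar> powr p) \<partial>wm w)
      = (\<integral>\<^sup>+x. ennreal (w x) * (ennreal (\<bar>T h x\<bar> powr p) * indicator ?Q x) \<partial>lebesgue)"
      by (intro nn_integral_wm[OF w]) measurable
    also have "\<dots> \<le> (\<integral>\<^sup>+x. ennreal (m powr (\<sigma> / p) / v) * (ennreal (\<bar>T h x\<bar> powr \<sigma>) * indicator ?Q x)
        + ennreal ((v / m) powr r / v) * (ennreal (w x powr r) * indicator ?Q x)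
        + ennreal (1 / v) * indicator ?Q x \<partial>lebesgue)"
    proof (intro nn_integral_mono)
      fix x
      show "ennreal (w x) * (ennreal (\<bar>T h x\<bar> powr p) * indicator ?Q x)
        \<le> ennreal (m powr (\<sigma> / p) / v) * (ennreal (\<bar>T h x\<bar> powr \<sigma>) * indicator ?Q x)
        + ennreal ((v / m) powr r / v) * (ennreal (w x powr r) * indicator ?Q x)
        + ennreal (1 / v) * indicator ?Q x"
      proof (cases "x \<in> ?Q")
        case True
        have "ennreal (w x * \<bar>T h x\<bar> powr p) \<le> ennreal ((m powr (\<sigma> / p) / v) * \<bar>T h x\<bar> powr \<sigma> + ((v / m) powr r / v) * w x powr r + 1 / v)"
          by (rule ennreal_leI) (rule pt)
        moreover have "\<dots> = ennreal (m powr (\<sigma> / p) / v) * ennreal (\<bar>T h x\<bar> powr \<sigma>)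
            + ennreal ((v / m) powr r / v) * ennreal (w x powr r) + ennreal (1 / v)"
          using v by (simp add: ennreal_mult[symmetric] ennreal_plus[symmetric] del: ennreal_plus)
        ultimately show ?thesis using True wnn[of x] by (simp add: ennreal_mult)
      qed simp
    qed
    also have "\<dots> = ennreal (m powr (\<sigma> / p) / v) * (\<integral>\<^sup>+x\<in>?Q. ennreal (\<bar>T h x\<bar> powr \<sigma>) \<partial>lebesgue)
        + ennreal ((v / m) powr r / v) * (\<integral>\<^sup>+x\<in>?Q. ennreal (w x powr r) \<partial>lebesgue)
        + ennreal (1 / v) * ennreal (?d ^ ?n * v)"
      by (simp add: nn_integral_add nn_integral_cmult emeasure_cube[OF dl] vd)
    also have "\<dots> \<le> ennreal (m powr (\<sigma> / p) / v) * ennreal (C powr \<sigma> * v / m powr (\<sigma> / p))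
        + ennreal ((v / m) powr r / v) * ennreal (?d ^ ?n * v * (G * m / v) powr r)
        + ennreal (1 / v) * ennreal (?d ^ ?n * v)"
      using IX IY by (intro add_mono mult_left_mono) auto
    also have "\<dots> = ennreal (m powr (\<sigma> / p) / v * (C powr \<sigma> * v / m powr (\<sigma> / p))
        + ((v / m) powr r / v) * (?d ^ ?n * v * (G * m / v) powr r) + 1 / v * (?d ^ ?n * v))"
      using v d by (simp add: ennreal_mult[symmetric] ennreal_plus[symmetric] del: ennreal_plus)
    also have "m powr (\<sigma> / p) / v * (C powr \<sigma> * v / m powr (\<sigma> / p)) = C powr \<sigma>"
      using v m by simp
    also have "((v / m) powr r / v) * (?d ^ ?n * v * (G * m / v) powr r) = ?d ^ ?n * ((v / m) powr r * (G * m / v) powr r)"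
      using v by simp
    also have "(v / m) powr r * (G * m / v) powr r = G powr r"
      using v m G0 by (simp add: powr_mult[symmetric])
    finally show "(\<integral>\<^sup>+x\<in>?Q. ennreal (\<bar>T h x\<bar> powr p) \<partial>wm w) \<le> ennreal K"
      using v by (simp add: K_def)
  qed
qed

text \<open>The complement of \<open>2 n^(1/2) Q\<close> is covered by the shells between the cubes with the factors \<open>2^j\<close>
  and \<open>2^(j+1)\<close>. On such a shell \<open>|x - x\<^sub>0| > 2^j n^(1/2) l \<ge> 2^j l\<close>, which gives
  \<open>|T h|^p \<le> a\<^sub>j = (2 C)^p w(Q)^(-1) 2^(-jnp)\<close>, and the outer cube has weight at most
  \<open>C 2^(jnq) w(Q)\<close>. The sum over \<open>j\<close> is a geometric series with the ratio \<open>\<rho> = 2^(-n(p-q)) < 1\<close>.\<close>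

lemma image_off_cube:
  fixes w :: "real ^ 'n \<Rightarrow> real"
  assumes p: "0 < p" and w: "weight w" and D: "D_class q w" and q: "q < p" and s: "1 \<le> s"
    and pos: "\<And>c l. 0 < l \<Longrightarrow> 0 < measure (wm w) (cube c l)"
    and est: "block_estimates p s w C T" and C: "0 \<le> C"
    and T_meas: "\<And>h. block p s w h \<Longrightarrow> T h \<in> borel_measurable lebesgue"
  shows "\<exists>K\<ge>0. \<forall>h c l. block_on p s w c l h \<longrightarrow>
    (\<integral>\<^sup>+x\<in>- cube c (2 * sqrt (real CARD('n)) * l). ennreal (\<bar>T h x\<bar> powr p) \<partial>wm w) \<le> ennreal K"
proof -
  let ?d = "2 * sqrt (real CARD('n))"
  let ?n = "CARD('n)"
  have d: "1 < ?d" by (rule two_sqrt_card_gt_1)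
  obtain D where D0: "0 \<le> D" and D: "\<And>c l t. 0 < l \<Longrightarrow> 1 < t \<Longrightarrow>
     measure (wm w) (cube c (t * l)) \<le> D * t powr (real CARD('n) * q) * measure (wm w) (cube c l)"
    using D_classD[OF D] by blast
  define \<rho> where "\<rho> = 2 powr (- (real ?n * (p - q)))"
  have \<rho>: "0 < \<rho>" "\<rho> < 1"
    using q card_ge_1[where 'n='n] by (auto simp: \<rho>_def powr_less_one)
  define B where "B = (2 * C) powr p * (D * (2 * ?d) powr (real ?n * q))"
  have B0: "0 \<le> B" using D0 by (simp add: B_def)
  show ?thesis
  proof (intro exI[of _ "B * (1 / (1 - \<rho>))"] conjI allI impI)
    show "0 \<le> B * (1 / (1 - \<rho>))" using B0 \<rho> by simp
    fix h c l assume hb: "block_on p s w c l h"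
    then have l: "0 < l" and sub: "closure {x. h x \<noteq> 0} \<subseteq> cube c l" by (auto simp: block_on_def)
    have h: "block p s w h" using hb block_iff_block_on[OF pos] by blast
    note [measurable] = T_meas[OF h]
    define m where "m = measure (wm w) (cube c l)"
    have m: "0 < m" using pos l by (simp add: m_def)
    define Q where "Q k = cube c (2 ^ k * (?d * l))" for k :: nat
    define a where "a k = (2 * C) powr p / m * 2 powr (- (real k * real ?n * p))" for k :: nat
    have a0: "0 \<le> a k" for k using m by (simp add: a_def)
    have "AE x in lebesgue. x \<notin> cube c (?d * l) \<longrightarrow>
           ennreal \<bar>T h x\<bar> \<le> ennreal C * Lnorm lebesgue 1 h / ennreal (norm (x - c) ^ ?n)"
      using est h l sub unfolding block_estimates_def by blast
    then have "AE x in lebesgue. ennreal (\<bar>T h x\<bar> powr p) * indicator (- cube c (?d * l)) x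
        \<le> (\<Sum>k. ennreal (a k) * indicator (Q (Suc k)) x)"
    proof eventually_elim
      case (elim x)
      show ?case
      proof (cases "x \<in> cube c (?d * l)")
        case False
        have "\<exists>k. x \<in> Q k"
        proof -
          obtain k :: nat where k: "2 * norm (x - c) / (?d * l) < 2 ^ k"
            using real_arch_pow[of 2] by auto
          then have "2 * norm (x - c) \<le> 2 ^ k * (?d * l)" using l d by (simp add: field_simps)
          then show ?thesis unfolding Q_def by (blast intro: mem_cube_norm)
        qed
        then have "x \<in> Q (LEAST k. x \<in> Q k)" by (rule LeastI_ex)
        then obtain k where k: "x \<in> Q k" "\<And>j. j < k \<Longrightarrow> x \<notin> Q j"
          using not_less_Least by blast
        have "k \<noteq> 0"
        proof
          assume "k = 0"
          then show False using False k(1) by (simp add: Q_def)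
        qed
        then obtain j where j: "k = Suc j" using not0_implies_Suc by blast
        have "x \<notin> Q j" using k(2) j by simp
        then have "2 ^ j * (?d * l) < 2 * norm (x - c)"
          unfolding Q_def using mem_cube_norm by (metis not_le)
        moreover have "2 * (2 ^ j * l) \<le> 2 ^ j * (?d * l)"
          using l card_ge_1[where 'n='n] by simp
        ultimately have far: "2 ^ j * l < norm (x - c)" by linarith
        then have x0: "0 < norm (x - c)" using l by (intro less_trans[OF _ far]) simp
        have "ennreal \<bar>T h x\<bar> \<le> ennreal C * Lnorm lebesgue 1 h / ennreal (norm (x - c) ^ ?n)"
          using elim False by simp
        also have "\<dots> \<le> ennreal C * ennreal (2 * l ^ ?n * m powr (- 1 / p)) / ennreal (norm (x - c) ^ ?n)"
          unfolding m_def using block_on_L1[OF hb s pos[OF l]]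
          by (intro divide_right_mono_ennreal mult_left_mono) auto
        also have "\<dots> = ennreal (C * (2 * l ^ ?n * m powr (- 1 / p)) / norm (x - c) ^ ?n)"
          using C l x0 by (simp add: ennreal_mult[symmetric] divide_ennreal)
        also have "\<dots> \<le> ennreal (C * (2 * l ^ ?n * m powr (- 1 / p)) / (2 ^ j * l) ^ ?n)"
          using C l far by (intro ennreal_leI divide_left_mono power_mono mult_pos_pos zero_less_power x0) auto
        also have "C * (2 * l ^ ?n * m powr (- 1 / p)) / (2 ^ j * l) ^ ?n = 2 * C * m powr (- 1 / p) / (2 ^ j) ^ ?n"
          using l by (simp add: power_mult_distrib)
        finally have "\<bar>T h x\<bar> \<le> 2 * C * m powr (- 1 / p) / (2 ^ j) ^ ?n"
          using C by (subst (asm) ennreal_le_iff) auto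
        then have "\<bar>T h x\<bar> powr p \<le> (2 * C * m powr (- 1 / p) / (2 ^ j) ^ ?n) powr p"
          using p by (intro powr_mono2) auto
        also have "\<dots> = (2 * C) powr p / m / ((2 ^ j) ^ ?n) powr p"
          using C by (simp add: powr_divide powr_mult powr_minus_inverse_exponent[OF p m] del: powr_minus)
        also have "((2 ^ j) ^ ?n :: real) = 2 powr (real j * real ?n)"
          by (simp add: powr_realpow[symmetric] powr_powr power_mult[symmetric])
        also have "(2 * C) powr p / m / (2 powr (real j * real ?n)) powr p = a j"
          by (simp add: a_def powr_powr powr_minus divide_inverse)
        finally have "ennreal (\<bar>T h x\<bar> powr p) \<le> ennreal (a j)" by (rule ennreal_leI)
        also have "\<dots> = (\<Sum>k\<in>{j}. ennreal (a k) * indicator (Q (Suc k)) x)"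
          using k(1) j by simp
        also have "\<dots> \<le> (\<Sum>k. ennreal (a k) * indicator (Q (Suc k)) x)"
          by (intro sum_le_suminf) auto
        finally show ?thesis using False by simp
      qed simp
    qed
    then have "(\<integral>\<^sup>+x\<in>- cube c (?d * l). ennreal (\<bar>T h x\<bar> powr p) \<partial>wm w)
       \<le> (\<integral>\<^sup>+x. (\<Sum>k. ennreal (a k) * indicator (Q (Suc k)) x) \<partial>wm w)"
      by (intro nn_integral_mono_AE AE_wm_if_lebesgue[OF w])
    also have "\<dots> = (\<Sum>k. ennreal (a k) * emeasure (wm w) (Q (Suc k)))"
      by (subst nn_integral_suminf) (auto simp: Q_def nn_integral_cmult)
    also have "\<dots> \<le> (\<Sum>k. ennreal (B * \<rho> ^ k))"
    proof (intro suminf_le allI)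
      fix k
      have "measure (wm w) (Q (Suc k)) \<le> D * (2 ^ Suc k * ?d) powr (real ?n * q) * m"
      proof -
        have "1 * 1 < 2 ^ Suc k * ?d"
          using d by (intro mult_strict_mono' one_less_power) auto
        then have "1 < 2 ^ Suc k * ?d" by simp
        then show ?thesis using D[OF l, of "2 ^ Suc k * ?d" c] by (simp add: Q_def m_def mult.assoc)
      qed
      then have "a k * measure (wm w) (Q (Suc k)) \<le> a k * (D * (2 ^ Suc k * ?d) powr (real ?n * q) * m)"
        using a0 by (intro mult_left_mono) auto
      also have "(2 ^ Suc k * ?d) powr (real ?n * q) = (2 * ?d) powr (real ?n * q) * 2 powr (real k * (real ?n * q))"
      proof -
        have "2 ^ Suc k * ?d = (2 * ?d) * 2 powr (real k)" by (simp add: powr_realpow)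
        then show ?thesis using d by (simp only: powr_mult powr_powr)
      qed
      also have "a k * (D * ((2 * ?d) powr (real ?n * q) * 2 powr (real k * (real ?n * q))) * m)
         = B * (2 powr (- (real k * real ?n * p)) * 2 powr (real k * (real ?n * q)))"
        using m by (simp add: a_def B_def)
      also have "2 powr (- (real k * real ?n * p)) * 2 powr (real k * (real ?n * q)) = \<rho> powr (real k)"
        by (simp add: \<rho>_def powr_powr powr_add[symmetric] algebra_simps)
      also have "\<rho> powr (real k) = \<rho> ^ k" using \<rho> by (simp add: powr_realpow)
      finally have "ennreal (a k * measure (wm w) (Q (Suc k))) \<le> ennreal (B * \<rho> ^ k)" by (rule ennreal_leI)
      then show "ennreal (a k) * emeasure (wm w) (Q (Suc k)) \<le> ennreal (B * \<rho> ^ k)"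
        unfolding Q_def emeasure_wm_cube(3)[OF w] using a0 by (simp add: ennreal_mult)
    qed auto
    also have "\<dots> = ennreal (B * (1 / (1 - \<rho>)))"
      using \<rho> B0 by (subst suminf_ennreal2) (auto simp: suminf_mult suminf_geometric summable_geometric)
    finally show "(\<integral>\<^sup>+x\<in>- cube c (?d * l). ennreal (\<bar>T h x\<bar> powr p) \<partial>wm w) \<le> ennreal (B * (1 / (1 - \<rho>)))" .
  qed
qed

lemma block_image_Lp:
  fixes w :: "real ^ 'n \<Rightarrow> real"
  assumes p: "0 < p" and w: "weight w" and est: "block_estimates p s w C T"
    and cases:
      "(\<exists>q. 0 < q \<and> q < p \<and> D_class q w \<and> s = top) \<or>
       (\<exists>q r. 0 < q \<and> q < p \<and> 1 < r \<and> A_class q r w \<and> ennreal (max (r * p / (r - 1)) 1) \<le> s)"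
    and T_meas: "\<And>h. block p s w h \<Longrightarrow> T h \<in> borel_measurable lebesgue"
  shows "\<exists>A\<ge>0. \<forall>h. block p s w h \<longrightarrow> (\<integral>\<^sup>+x. ennreal (\<bar>T h x\<bar> powr p) \<partial>wm w) \<le> ennreal A"
proof -
  obtain q where q: "q < p" "D_class q w" using cases by (auto simp: A_class_def)
  have s: "1 \<le> s"
  proof -
    have "ennreal 1 \<le> ennreal (max (r * p / (r - 1)) 1)" for r by (intro ennreal_leI) auto
    then have "1 \<le> ennreal (max (r * p / (r - 1)) 1)" for r by (simp only: ennreal_1)
    then show ?thesis using cases by (metis order_trans top_greatest)
  qed
  define C' where "C' = max C 0"
  have C': "0 \<le> C'" "block_estimates p s w C' T"
    using block_estimates_nonneg[OF est] by (auto simp: C'_def)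
  consider (null) "AE x in wm w. False" | (pos) "\<forall>c l. 0 < l \<longrightarrow> 0 < measure (wm w) (cube c l)"
    using wm_null_or_positive[OF w q(2)] by blast
  then show ?thesis
  proof cases
    case null
    then have "(\<integral>\<^sup>+x. ennreal (\<bar>T h x\<bar> powr p) \<partial>wm w) = (\<integral>\<^sup>+x. 0 \<partial>wm w)" for h
      by (intro nn_integral_cong_AE) (auto elim: eventually_mono)
    then show ?thesis by (intro exI[of _ 0]) auto
  next
    case pos
    obtain K1 where K1: "0 \<le> K1" "\<And>h c l. block_on p s w c l h \<Longrightarrow>
      (\<integral>\<^sup>+x\<in>cube c (2 * sqrt (real CARD('n)) * l). ennreal (\<bar>T h x\<bar> powr p) \<partial>wm w) \<le> ennreal K1"
    proof (cases "s = top")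
      case True
      then show ?thesis
        using image_on_cube_bounded[OF p w q(2), of C' T] pos C' T_meas that by auto
    next
      case False
      then obtain r where r: "1 < r" "RH_class r w" "ennreal (max (r * p / (r - 1)) 1) \<le> s"
        using cases by (auto simp: A_class_def)
      obtain \<sigma> where \<sigma>: "s = ennreal \<sigma>" "1 \<le> \<sigma>" using exponent_cases[OF s] False by metis
      have "r * p / (r - 1) \<le> \<sigma>" using r(3) \<sigma> by (simp add: ennreal_le_iff)
      then show ?thesis
        using image_on_cube_reverse_Hoelder[OF p w q(2) r(2,1) \<sigma>(2), of C' T] pos C' T_meas \<sigma>(1) that by auto
    qed
    obtain K2 where K2: "0 \<le> K2" "\<And>h c l. block_on p s w c l h \<Longrightarrow>
      (\<integral>\<^sup>+x\<in>- cube c (2 * sqrt (real CARD('n)) * l). ennreal (\<bar>T h x\<bar> powr p) \<partial>wm w) \<le> ennreal K2"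
      using image_off_cube[OF p w q(2,1) s _ C'(2,1) T_meas] pos by auto
    show ?thesis
    proof (intro exI[of _ "K1 + K2"] conjI allI impI)
      show "0 \<le> K1 + K2" using K1 K2 by simp
      fix h assume h: "block p s w h"
      note [measurable] = T_meas[OF h]
      obtain c l where hb: "block_on p s w c l h" using h block_iff_block_on[of w p s h] pos by blast
      let ?Q = "cube c (2 * sqrt (real CARD('n)) * l)"
      have "(\<integral>\<^sup>+x. ennreal (\<bar>T h x\<bar> powr p) \<partial>wm w)
        = (\<integral>\<^sup>+x. ennreal (\<bar>T h x\<bar> powr p) * indicator ?Q x + ennreal (\<bar>T h x\<bar> powr p) * indicator (- ?Q) x \<partial>wm w)"
        by (intro nn_integral_cong) (auto split: split_indicator)
      also have "\<dots> = (\<integral>\<^sup>+x\<in>?Q. ennreal (\<bar>T h x\<bar> powr p) \<partial>wm w) + (\<integral>\<^sup>+x\<in>- ?Q. ennreal (\<bar>T h x\<bar> powr p) \<partial>wm w)"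
        by (intro nn_integral_add) measurable
      also have "\<dots> \<le> ennreal K1 + ennreal K2" using K1 K2 hb by (intro add_mono) auto
      finally show "(\<integral>\<^sup>+x. ennreal (\<bar>T h x\<bar> powr p) \<partial>wm w) \<le> ennreal (K1 + K2)"
        using K1 K2 by simp
    qed
  qed
qed

section \<open>Positivity of weights with a reverse Hoelder inequality\<close>

text \<open>A weak form of the Lebesgue density theorem. If a bounded piece \<open>S\<close> of \<open>Z\<close> had measure
  \<open>\<mu> > 0\<close>, one could take an open set \<open>U \<supseteq> S\<close> with \<open>|U| < (1 + \<eta>) \<mu>\<close> and cover \<open>S\<close> by
  non-overlapping cubes inside \<open>U\<close>. Summing the density bound over these cubes yields
  \<open>\<mu> \<le> (1 - \<eta>) |U| \<le> (1 - \<eta>\<^sup>2) \<mu>\<close>, a contradiction.\<close>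

lemma null_if_cube_density_le:
  fixes Z :: "(real ^ 'n) set"
  assumes Z [measurable]: "Z \<in> sets lebesgue" and \<eta>: "0 < \<eta>" "\<eta> \<le> 1"
    and dens: "\<And>c l. 0 < l \<Longrightarrow> measure lebesgue (cube c l \<inter> Z) \<le> (1 - \<eta>) * measure lebesgue (cube c l)"
  shows "Z \<in> null_sets lebesgue"
proof -
  have "Z \<inter> cube 0 (real (Suc k)) \<in> null_sets lebesgue" for k
  proof (rule ccontr)
    define L where "L = real (Suc k)"
    define S where "S = Z \<inter> cube 0 L"
    define \<mu> where "\<mu> = measure lebesgue S"
    assume "Z \<inter> cube 0 (real (Suc k)) \<notin> null_sets lebesgue"
    then have nn: "S \<notin> null_sets lebesgue" by (simp add: S_def L_def)
    have L: "0 < L" by (simp add: L_def)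
    have S_lm: "S \<in> lmeasurable"
      unfolding S_def by (subst Int_commute) (intro fmeasurable_Int_fmeasurable cube_lmeasurable Z)
    then have Sm [measurable]: "S \<in> sets lebesgue" by (rule fmeasurableD)
    have eS: "emeasure lebesgue S = ennreal \<mu>"
      unfolding \<mu>_def using S_lm by (rule emeasure_eq_measure2)
    have \<mu>: "0 < \<mu>"
    proof (rule ccontr)
      assume "\<not> 0 < \<mu>"
      then have "\<mu> = 0" by (simp add: \<mu>_def less_le)
      then show False using nn eS Sm by auto
    qed
    have "0 < \<eta> * \<mu>" using \<eta> \<mu> by simp
    then obtain U where U: "open U" "S \<subseteq> U" "emeasure lebesgue (U - S) < ennreal (\<eta> * \<mu>)"
      by (rule sets_lebesgue_outer_open[OF Sm])
    define a b :: "real ^ 'n" where "a = (\<chi> i. 0 $ i - L / 2)" and "b = (\<chi> i. 0 $ i + L / 2)"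
    have "cbox a b = cube 0 L" by (simp only: cube_eq_cbox a_def b_def)
    then have S1: "S \<subseteq> cbox a b" unfolding S_def by blast
    have "0 \<in> box a b" using L by (simp add: mem_box_cart a_def b_def)
    then have "box a b \<noteq> {}" by blast
    moreover have "gauge (\<lambda>x. if x \<in> U then U else UNIV)" using U(1) by (auto simp: gauge_def)
    moreover note S1
    ultimately obtain \<D> where D: "countable \<D>" "\<Union>\<D> \<subseteq> cbox a b"
      "\<And>K. K \<in> \<D> \<Longrightarrow> interior K \<noteq> {} \<and> (\<exists>c d. K = cbox c d)"
      "pairwise (\<lambda>A B. interior A \<inter> interior B = {}) \<D>"
      "\<And>K. K \<in> \<D> \<Longrightarrow> \<exists>x \<in> S \<inter> K. K \<subseteq> (if x \<in> U then U else UNIV)"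
      "\<And>u v. cbox u v \<in> \<D> \<Longrightarrow> \<exists>n. \<forall>i \<in> Basis. v \<bullet> i - u \<bullet> i = (b \<bullet> i - a \<bullet> i) / 2^n"
      "S \<subseteq> \<Union>\<D>"
      by - (erule (2) covering_lemma, blast)
    have is_cube: "\<exists>c l. 0 < l \<and> K = cube c l" if K: "K \<in> \<D>" for K
    proof -
      obtain u v where uv: "K = cbox u v" using D(3)[OF K] by blast
      then obtain n where n: "\<forall>i \<in> Basis. v \<bullet> i - u \<bullet> i = (b \<bullet> i - a \<bullet> i) / 2^n" using D(6) K by blast
      define l where "l = L / 2 ^ n"
      have "v $ i - u $ i = l" for i
        using n[rule_format, of "axis i 1"] by (simp add: inner_axis a_def b_def l_def axis_in_Basis_iff)
      then have v: "v $ i = u $ i + l" for i by (metis add.commute diff_add_cancel)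
      have "K = cube (\<chi> i. u $ i + l / 2) l"
        unfolding uv cube_eq_cbox
        by (intro arg_cong2[where f=cbox]) (auto simp: vec_eq_iff v)
      moreover have "0 < l" using L by (simp add: l_def)
      ultimately show ?thesis by blast
    qed
    have K_sets [measurable]: "K \<in> sets lebesgue" if "K \<in> \<D>" for K using is_cube[OF that] by auto
    have intK: "interior K \<in> sets lebesgue" for K :: "(real ^ 'n) set" by (simp add: borel_open)
    have bd: "K - interior K \<in> null_sets lebesgue" if K: "K \<in> \<D>" for K
    proof -
      obtain u v where uv: "K = cbox u v" using D(3)[OF K] by blast
      show ?thesis
        unfolding uv interior_cbox using negligible_frontier_interval[of u v]
        by (simp only: negligible_iff_null_sets)
    qed
    \<comment> \<open>The cubes only have disjoint interiors, so their boundaries are discarded as a null set.\<close>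
    define N where "N = (\<Union>K\<in>\<D>. K - interior K)"
    have N: "N \<in> null_sets lebesgue"
      unfolding N_def using D(1) bd by (intro null_sets_UN') auto
    have disj: "disjoint_family_on (\<lambda>K. interior K) \<D>"
      using D(4) by (auto simp: disjoint_family_on_def pairwise_def)
    have each: "emeasure lebesgue (interior K \<inter> S) \<le> ennreal (1 - \<eta>) * emeasure lebesgue (interior K)" if K: "K \<in> \<D>" for K
    proof -
      obtain c l where cl: "0 < l" "K = cube c l" using is_cube[OF K] by blast
      have "emeasure lebesgue (interior K \<inter> S) \<le> emeasure lebesgue (cube c l \<inter> Z)"
        using cl(2) interior_subset[of K] by (intro emeasure_mono) (auto simp: S_def)
      also have "\<dots> = ennreal (measure lebesgue (cube c l \<inter> Z))"
        by (intro emeasure_eq_measure2 fmeasurable_Int_fmeasurable) auto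
      also have "\<dots> \<le> ennreal ((1 - \<eta>) * measure lebesgue (cube c l))" by (intro ennreal_leI dens cl)
      also have "\<dots> = ennreal (1 - \<eta>) * emeasure lebesgue K"
        using \<eta> unfolding cl(2) emeasure_eq_measure2[OF cube_lmeasurable] by (simp add: ennreal_mult)
      also have "emeasure lebesgue K = emeasure lebesgue (interior K)"
      proof -
        have "K = interior K \<union> (K - interior K)" using interior_subset by blast
        then show ?thesis using bd[OF K] intK emeasure_Un_null_set by metis
      qed
      finally show ?thesis .
    qed
    have "emeasure lebesgue S = emeasure lebesgue (S - N)"
      using N by (simp add: emeasure_Diff_null_set)
    also have "\<dots> \<le> emeasure lebesgue (\<Union>K\<in>\<D>. interior K \<inter> S)"
      using D(1,7) intK by (intro emeasure_mono sets.countable_UN') (auto simp: N_def)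
    also have "\<dots> = (\<integral>\<^sup>+K. emeasure lebesgue (interior K \<inter> S) \<partial>count_space \<D>)"
      using D(1) disj intK by (intro emeasure_UN_countable) (auto simp: disjoint_family_on_def)
    also have "\<dots> \<le> (\<integral>\<^sup>+K. ennreal (1 - \<eta>) * emeasure lebesgue (interior K) \<partial>count_space \<D>)"
      using each by (intro nn_integral_mono) auto
    also have "\<dots> = ennreal (1 - \<eta>) * emeasure lebesgue (\<Union>K\<in>\<D>. interior K)"
      using D(1) disj intK by (subst emeasure_UN_countable) (auto simp: nn_integral_cmult)
    also have "\<dots> \<le> ennreal (1 - \<eta>) * emeasure lebesgue (S \<union> (U - S))"
    proof (intro mult_left_mono emeasure_mono)
      show "(\<Union>K\<in>\<D>. interior K) \<subseteq> S \<union> (U - S)"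
      proof
        fix x assume "x \<in> (\<Union>K\<in>\<D>. interior K)"
        then obtain K where K: "K \<in> \<D>" "x \<in> interior K" by blast
        then obtain y where y: "y \<in> S" "K \<subseteq> (if y \<in> U then U else UNIV)" using D(5) by blast
        then have "y \<in> U" using U(2) by blast
        then have "K \<subseteq> U" using y(2) by simp
        then show "x \<in> S \<union> (U - S)" using K(2) interior_subset by blast
      qed
    qed (use U(1) Sm in \<open>auto simp: borel_open\<close>)
    also have "\<dots> \<le> ennreal (1 - \<eta>) * (ennreal \<mu> + ennreal (\<eta> * \<mu>))"
      using U eS Sm by (intro mult_left_mono order_trans[OF emeasure_subadditive] add_mono) (auto simp: borel_open)
    also have "\<dots> = ennreal ((1 - \<eta>) * (\<mu> + \<eta> * \<mu>))"
      using \<eta> \<mu> by (simp add: ennreal_mult[symmetric] ennreal_plus[symmetric] del: ennreal_plus)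
    finally have "\<mu> \<le> (1 - \<eta>) * (\<mu> + \<eta> * \<mu>)"
      unfolding eS using \<eta> \<mu> by (subst (asm) ennreal_le_iff) auto
    then have "\<eta> * \<eta> * \<mu> \<le> 0" by (simp add: algebra_simps)
    moreover have "0 < \<eta> * \<eta> * \<mu>" using \<eta> \<mu> by simp
    ultimately show False by linarith
  qed
  then have "(\<Union>k. Z \<inter> cube 0 (real (Suc k))) \<in> null_sets lebesgue" by (intro null_sets_UN) auto
  moreover have "(\<Union>k. Z \<inter> cube 0 (real (Suc k))) = Z"
  proof -
    have "\<exists>k. x \<in> cube 0 (real (Suc k))" for x :: "real ^ 'n"
    proof -
      obtain k where "x \<in> cube 0 (real k)" using ex_centred_cube by blast
      then have "x \<in> cube 0 (real (Suc k))" using cube_mono[of "real k" "real (Suc k)" 0] by auto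
      then show ?thesis by blast
    qed
    then show ?thesis by auto
  qed
  ultimately show ?thesis by simp
qed

text \<open>Let \<open>Z = {w = 0}\<close>. On a cube \<open>Q\<close> with average \<open>m / v\<close> split \<open>w \<le> B + B^(1-r) w^r\<close> off \<open>Z\<close> at the
  height \<open>B = t m / v\<close>. The reverse Hoelder inequality makes the integral of the second term at most
  \<open>m / 2\<close> if \<open>t\<close> is large, and then \<open>m \<le> B |Q - Z| + m / 2\<close> says that \<open>Z\<close> misses at least the
  fraction \<open>1 / (2 t)\<close> of every cube.\<close>

lemma weight_positive_AE:
  fixes w :: "real ^ 'n \<Rightarrow> real"
  assumes w: "weight w" and RH: "RH_class r w" and r: "1 < r"
    and pos: "\<And>c l. 0 < l \<Longrightarrow> 0 < measure (wm w) (cube c l)"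
  shows "AE x in lebesgue. 0 < w x"
proof -
  let ?n = "CARD('n)"
  note [measurable] = weight_measurable[OF w]
  have wnn: "0 \<le> w x" for x using w by (simp add: weight_def)
  obtain R where R0: "0 \<le> R" and R: "\<And>c l. 0 < l \<Longrightarrow>
    (\<integral>\<^sup>+x\<in>cube c l. ennreal (w x powr r) \<partial>lebesgue)
      \<le> ennreal (l ^ CARD('n) * (R * measure (wm w) (cube c l) / l ^ CARD('n)) powr r)"
    using RH_classD[OF w RH r] by blast
  \<comment> \<open>The height is chosen so that \<open>t^(1-r) R^r \<le> 1/2\<close>.\<close>
  define t where "t = (2 * R powr r + 1) powr (1 / (r - 1))"
  have t: "1 \<le> t" using r unfolding t_def by (intro ge_one_powr_ge_zero) auto
  have tr: "t powr (1 - r) * R powr r \<le> 1 / 2"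
  proof -
    have "t powr (1 - r) = (2 * R powr r + 1) powr (- 1)"
    proof -
      have "1 / (r - 1) * (1 - r) = - 1" using r by (simp add: field_simps)
      then show ?thesis by (simp only: t_def powr_powr)
    qed
    also have "\<dots> = 1 / (2 * R powr r + 1)" by (simp add: powr_minus_divide)
    finally show ?thesis by (simp add: field_simps add_pos_nonneg)
  qed
  define Z where "Z = {x. w x = 0}"
  have Zm [measurable]: "Z \<in> sets lebesgue"
  proof -
    have "{x \<in> space lebesgue. w x = 0} \<in> sets lebesgue" by measurable
    then show ?thesis by (simp add: Z_def)
  qed
  have "Z \<in> null_sets lebesgue"
  proof (rule null_if_cube_density_le[OF Zm])
    show "0 < 1 / (2 * t)" "1 / (2 * t) \<le> 1" using t by auto
    fix c :: "real ^ 'n" and l :: real assume l: "0 < l"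
    define v where "v = l ^ ?n"
    define m where "m = measure (wm w) (cube c l)"
    have v: "0 < v" using l by (simp add: v_def)
    have m: "0 < m" using pos[OF l] by (simp add: m_def)
    have t0: "0 < t" using t by linarith
    define B where "B = t * (m / v)"
    have B: "0 < B" using t0 m v by (simp add: B_def)
    have lm: "cube c l - Z \<in> lmeasurable" "cube c l \<inter> Z \<in> lmeasurable"
      by (auto intro: fmeasurable_Diff fmeasurable_Int_fmeasurable)
    define d where "d = measure lebesgue (cube c l - Z)"
    have "ennreal m = (\<integral>\<^sup>+x\<in>cube c l. ennreal (w x) \<partial>lebesgue)"
      by (simp add: m_def emeasure_wm_cube(1,3)[OF w, symmetric])
    also have "\<dots> \<le> (\<integral>\<^sup>+x. ennreal B * indicator (cube c l - Z) x
        + ennreal (B powr (1 - r)) * (ennreal (w x powr r) * indicator (cube c l) x) \<partial>lebesgue)"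
    proof (intro nn_integral_mono)
      fix x
      have *: "w x \<le> B + B powr (1 - r) * w x powr r"
      proof (cases "w x \<le> B")
        case False
        then have "w x = w x powr (1 - r) * w x powr r" using B wnn[of x] by (simp add: powr_add[symmetric])
        also have "\<dots> \<le> B powr (1 - r) * w x powr r"
          using False B r by (intro mult_right_mono powr_mono2') auto
        finally show ?thesis using B by linarith
      qed (simp add: add_increasing2)
      show "ennreal (w x) * indicator (cube c l) x \<le> ennreal B * indicator (cube c l - Z) x
        + ennreal (B powr (1 - r)) * (ennreal (w x powr r) * indicator (cube c l) x)"
      proof (cases "x \<in> cube c l \<and> x \<notin> Z")
        case True
        then show ?thesis using ennreal_leI[OF *] B by (simp add: ennreal_mult ennreal_plus)
      qed (auto simp: Z_def)
    qed
    also have "\<dots> = ennreal B * ennreal d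
        + ennreal (B powr (1 - r)) * (\<integral>\<^sup>+x\<in>cube c l. ennreal (w x powr r) \<partial>lebesgue)"
      unfolding d_def emeasure_eq_measure2[OF lm(1), symmetric]
      by (simp add: nn_integral_add nn_integral_cmult)
    also have "\<dots> \<le> ennreal B * ennreal d + ennreal (B powr (1 - r)) * ennreal (v * (R * m / v) powr r)"
      using R[OF l, of c] by (intro add_mono mult_left_mono) (auto simp: v_def m_def)
    also have "\<dots> = ennreal (B * d + B powr (1 - r) * (v * (R * m / v) powr r))"
      using B v by (simp add: d_def ennreal_mult[symmetric] ennreal_plus[symmetric] del: ennreal_plus)
    finally have "m \<le> B * d + B powr (1 - r) * (v * (R * m / v) powr r)"
      using B v by (subst (asm) ennreal_le_iff) (auto simp: d_def)
    also have "B powr (1 - r) * (v * (R * m / v) powr r) = t powr (1 - r) * R powr r * m"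
    proof -
      have "(R * m / v) powr r = R powr r * (m / v) powr r"
        using R0 m v by (simp add: powr_mult[symmetric])
      moreover have "B powr (1 - r) = t powr (1 - r) * (m / v) powr (1 - r)"
        using t0 m v by (simp add: B_def powr_mult del: times_divide_eq_right)
      moreover have "(m / v) powr (1 - r) * (m / v) powr r = m / v"
        using m v by (simp add: powr_add[symmetric])
      ultimately show ?thesis using v by (simp add: field_simps)
    qed
    also have "\<dots> \<le> 1 / 2 * m" using tr m by (intro mult_right_mono) auto
    finally have "m / 2 \<le> B * d" by linarith
    then have "m / 2 \<le> t * (m / v) * d" by (simp only: B_def)
    then have "v / (2 * t) \<le> d" using m v t0 by (simp add: field_simps)
    moreover have "d = v - measure lebesgue (cube c l \<inter> Z)"
    proof -
      have "measure lebesgue (cube c l) = measure lebesgue (cube c l \<inter> Z) + measure lebesgue (cube c l - Z)"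
        using lm by (subst measure_Union[symmetric]) (auto simp: Int_Diff_Un fmeasurable_def)
      then show ?thesis by (simp add: d_def v_def measure_cube[OF l])
    qed
    ultimately show "measure lebesgue (cube c l \<inter> Z) \<le> (1 - 1 / (2 * t)) * measure lebesgue (cube c l)"
      unfolding measure_cube[OF l] v_def[symmetric] by (simp add: algebra_simps)
  qed
  then have "AE x in lebesgue. x \<notin> Z" by (rule AE_not_in)
  then show ?thesis
    by eventually_elim (use wnn in \<open>auto simp: Z_def less_le\<close>)
qed

section \<open>Truncation of block series\<close>

lemma closure_support_mono:
  fixes k h :: "'a :: topological_space \<Rightarrow> real"
  assumes "\<And>x. \<bar>k x\<bar> \<le> \<bar>h x\<bar>"
  shows "closure {x. k x \<noteq> 0} \<subseteq> closure {x. h x \<noteq> 0}"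
proof (rule closure_mono, rule Collect_mono, rule impI)
  fix x assume "k x \<noteq> 0"
  then show "h x \<noteq> 0" using assms[of x] by auto
qed

lemma block_mono:
  assumes s: "0 < s" and h: "block p s w h" and k: "k \<in> borel_measurable lebesgue"
    and le: "\<And>x. \<bar>k x\<bar> \<le> \<bar>h x\<bar>"
  shows "block p s w k"
proof -
  obtain c l where cl: "h \<in> Lspace lebesgue s" "0 < l" "closure {x. h x \<noteq> 0} \<subseteq> cube c l"
    and b: "Lnorm lebesgue s h \<le> ennreal (measure lebesgue (cube c l) powr enn2real (inverse s))
                             * inverse (ennreal (measure (wm w) (cube c l) powr (1 / p)))"
    using h by (auto simp: block_def)
  have "k \<in> Lspace lebesgue s" by (rule Lspace_mono[OF s k _ cl(1)]) (simp add: le)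
  moreover have "closure {x. k x \<noteq> 0} \<subseteq> cube c l"
    using closure_support_mono[OF le] cl(3) by (rule order_trans)
  moreover have "Lnorm lebesgue s k \<le> Lnorm lebesgue s h" by (rule Lnorm_mono[OF s k]) (simp add: le)
  ultimately show ?thesis unfolding block_def using cl(2) b order_trans by blast
qed

text \<open>Blocks span the space of all functions in \<open>L^s\<close> with bounded support: only the size has to be
  normalised. If \<open>w(Q) = 0\<close> the admissible size is infinite and every scaling factor will do.\<close>

lemma scaled_block:
  assumes s: "0 < s" and g: "g \<in> Lspace lebesgue s" and l: "0 < l"
    and sub: "closure {x. g x \<noteq> 0} \<subseteq> cube c l"
  shows "\<exists>k>0. block p s w (\<lambda>x. k * g x)"
proof -
  define E where "E = ennreal (measure lebesgue (cube c l) powr enn2real (inverse s))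
                             * inverse (ennreal (measure (wm w) (cube c l) powr (1 / p)))"
  have "measure lebesgue (cube c l) powr enn2real (inverse s) \<noteq> 0"
    using l by (simp add: measure_cube)
  then have "0 < E"
    unfolding E_def by (simp add: ennreal_zero_less_mult_iff less_le ennreal_eq_0_iff not_le)
  then obtain \<beta> where \<beta>: "0 < \<beta>" "ennreal \<beta> \<le> E"
  proof (cases E rule: ennreal_cases)
    case (real r)
    then show ?thesis using \<open>0 < E\<close> that[of r] by simp
  next
    case top
    then show ?thesis using that[of 1] by simp
  qed
  obtain b where b: "0 \<le> b" "Lnorm lebesgue s g = ennreal b"
    using g by (cases "Lnorm lebesgue s g" rule: ennreal_cases) (auto simp: Lspace_def)
  define k where "k = \<beta> / (b + 1)"
  have k: "0 < k" using \<beta> b by (simp add: k_def)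
  have "Lnorm lebesgue s (\<lambda>x. k * g x) \<le> ennreal (\<bar>k\<bar> * b)"
    using s g b by (intro Lnorm_scale_le) (auto simp: Lspace_def)
  also have "\<dots> \<le> ennreal \<beta>"
    using k \<beta> b by (intro ennreal_leI) (simp add: k_def field_simps)
  also note \<beta>(2)
  finally have "Lnorm lebesgue s (\<lambda>x. k * g x) \<le> E" .
  moreover have "{x. k * g x \<noteq> 0} = {x. g x \<noteq> 0}" using k by auto
  ultimately have "block p s w (\<lambda>x. k * g x)"
    unfolding block_def E_def using Lspace_scale[OF s g] sub l by auto
  then show ?thesis using k by blast
qed

lemma finite_sum_scaled_block:
  fixes a :: "nat \<Rightarrow> real ^ 'n \<Rightarrow> real"
  assumes s: "0 < s" and a: "\<And>j. j < N \<Longrightarrow> block p s w (a j)"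
  shows "\<exists>k>0. block p s w (\<lambda>x. k * (\<Sum>j<N. lam j * a j x))"
proof -
  have "\<exists>L>0. closure {x. a j x \<noteq> 0} \<subseteq> cube 0 L" if j: "j < N" for j
  proof -
    obtain c l where cl: "0 < l" "closure {x. a j x \<noteq> 0} \<subseteq> cube c l"
      using a[OF j] by (auto simp: block_def)
    then have "closure {x. a j x \<noteq> 0} \<subseteq> cube 0 (l + 2 * norm c)"
      using cube_subset_centred[of l c "l + 2 * norm c"] by auto
    then show ?thesis using cl(1) by (meson add_pos_nonneg norm_ge_zero mult_nonneg_nonneg zero_le_numeral)
  qed
  then obtain L where L: "\<And>j. j < N \<Longrightarrow> 0 < L j" "\<And>j. j < N \<Longrightarrow> closure {x. a j x \<noteq> 0} \<subseteq> cube 0 (L j)"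
    by metis
  define M where "M = 1 + (\<Sum>j<N. L j)"
  have M: "0 < M" unfolding M_def using L(1) by (intro add_pos_nonneg sum_nonneg) (auto intro: less_imp_le)
  have LM: "L j \<le> M" if "j < N" for j
  proof -
    have "L j \<le> (\<Sum>j<N. L j)" using that L(1) by (intro member_le_sum) (auto intro: less_imp_le)
    then show ?thesis by (simp add: M_def)
  qed
  have "closure {x. (\<Sum>j<N. lam j * a j x) \<noteq> 0} \<subseteq> cube 0 M"
  proof (intro closure_minimal subsetI)
    fix x assume "x \<in> {x. (\<Sum>j<N. lam j * a j x) \<noteq> 0}"
    then obtain j where j: "j < N" "a j x \<noteq> 0"
      by (metis (mono_tags, lifting) mem_Collect_eq mult_zero_right sum.neutral lessThan_iff)
    then have "x \<in> cube 0 (L j)" using L(2)[OF j(1)] closure_subset[of "{x. a j x \<noteq> 0}"] by auto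
    then show "x \<in> cube 0 M" using cube_mono[OF LM[OF j(1)]] by auto
  qed simp
  moreover have "(\<lambda>x. \<Sum>j<N. lam j * a j x) \<in> Lspace lebesgue s"
    using a by (intro Lspace_sum[OF s]) (auto simp: block_def)
  ultimately show ?thesis using scaled_block[OF s _ M] by blast
qed

text \<open>Let \<open>F\<^sub>N = \<Sum>\<^sub>i\<^sub><\<^sub>N |\<mu>\<^sub>i a\<^sub>i|\<close>. The functions \<open>b\<^sub>N = sgn(G) min(|G|, F\<^sub>N)\<close> increase to \<open>G\<close> in absolute
  value almost everywhere, since \<open>|G| \<le> lim F\<^sub>N\<close> there, and their increments are at most \<open>|\<mu>\<^sub>N a\<^sub>N|\<close>; hence
  \<open>c\<^sub>N = (b\<^sub>N\<^sub>+\<^sub>1 - b\<^sub>N) / |\<mu>\<^sub>N|\<close> is again a block. The remainder \<open>R\<^sub>N = G - b\<^sub>N\<close> is a block too and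
  tends to \<open>0\<close> in \<open>L^\<sigma>\<close> by dominated convergence, which is where \<open>\<sigma> < \<infinity>\<close> enters. By
  finite linearity \<open>T G = T R\<^sub>N + \<Sum>\<^sub>j\<^sub><\<^sub>N |\<mu>\<^sub>j| T c\<^sub>j\<close>, and \<open>T R\<^sub>N \<rightarrow> 0\<close> in \<open>L^\<sigma>\<close> on every cube.\<close>

lemma dominated_by_truncated_blocks:
  fixes w :: "real ^ 'n \<Rightarrow> real"
  assumes \<sigma>: "1 \<le> \<sigma>" and w: "weight w" and wpos: "AE x in lebesgue. 0 < w x"
    and est: "block_estimates p (ennreal \<sigma>) w C T" and C: "0 \<le> C"
    and T_meas: "\<And>h. block p (ennreal \<sigma>) w h \<Longrightarrow> T h \<in> borel_measurable lebesgue"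
    and lin: "linear_on_blocks p (ennreal \<sigma>) w T"
    and G: "block p (ennreal \<sigma>) w G" and ser: "block_series p (ennreal \<sigma>) w \<mu> a G"
  shows "\<exists>c. (\<forall>j. block p (ennreal \<sigma>) w (c j)) \<and>
    (AE x in wm w. ennreal \<bar>T G x\<bar> \<le> (\<Sum>j. ennreal (\<bar>\<mu> j\<bar> * \<bar>T (c j) x\<bar>)))"
proof -
  have s0: "0 < ennreal \<sigma>" using \<sigma> by simp
  have a: "block p (ennreal \<sigma>) w (a j)" for j using ser by (simp add: block_series_def)
  have [measurable]: "a j \<in> borel_measurable lebesgue" for j using a[of j] by (auto simp: block_def Lspace_def)
  have [measurable]: "G \<in> borel_measurable lebesgue" using G by (auto simp: block_def Lspace_def)
  define F where "F N x = (\<Sum>i<N. \<bar>\<mu> i\<bar> * \<bar>a i x\<bar>)" for N x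
  have F0: "0 \<le> F N x" for N x unfolding F_def by (intro sum_nonneg) auto
  define b where "b N x = sgn (G x) * min \<bar>G x\<bar> (F N x)" for N x
  define c where "c j x = (b (Suc j) x - b j x) / \<bar>\<mu> j\<bar>" for j x
  define R where "R N x = G x - b N x" for N x
  have [measurable]: "F N \<in> borel_measurable lebesgue" for N unfolding F_def by measurable
  have [measurable]: "b N \<in> borel_measurable lebesgue" for N unfolding b_def by measurable
  have bstep: "\<bar>b (Suc j) x - b j x\<bar> \<le> \<bar>\<mu> j\<bar> * \<bar>a j x\<bar>" for j x
  proof -
    have "F (Suc j) x = F j x + \<bar>\<mu> j\<bar> * \<bar>a j x\<bar>" by (simp add: F_def)
    moreover have "0 \<le> \<bar>\<mu> j\<bar> * \<bar>a j x\<bar>" by simp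
    ultimately have "\<bar>min \<bar>G x\<bar> (F (Suc j) x) - min \<bar>G x\<bar> (F j x)\<bar> \<le> \<bar>\<mu> j\<bar> * \<bar>a j x\<bar>"
      by linarith
    moreover have "\<bar>b (Suc j) x - b j x\<bar> \<le> \<bar>min \<bar>G x\<bar> (F (Suc j) x) - min \<bar>G x\<bar> (F j x)\<bar>"
      unfolding b_def by (cases "G x > 0"; cases "G x = 0") (auto simp: sgn_if)
    ultimately show ?thesis by linarith
  qed
  have c: "block p (ennreal \<sigma>) w (c j)" for j
  proof (rule block_mono[OF s0 a[of j]])
    show "c j \<in> borel_measurable lebesgue" unfolding c_def by measurable
    show "\<bar>c j x\<bar> \<le> \<bar>a j x\<bar>" for x
      using bstep[of j x] by (cases "\<mu> j = 0") (auto simp: c_def field_simps)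
  qed
  \<comment> \<open>If \<open>\<mu>\<^sub>j = 0\<close> both sides vanish, as the increment is at most \<open>|\<mu>\<^sub>j a\<^sub>j|\<close>.\<close>
  have mu_c: "\<bar>\<mu> j\<bar> * c j x = b (Suc j) x - b j x" for j x
    using bstep[of j x] by (cases "\<mu> j = 0") (auto simp: c_def)
  have sum_c: "(\<Sum>j<N. \<bar>\<mu> j\<bar> * c j x) = b N x" for N x
    unfolding mu_c by (subst sum_lessThan_telescope) (simp add: b_def F_def)
  have Rabs: "\<bar>R N x\<bar> = \<bar>G x\<bar> - min \<bar>G x\<bar> (F N x)" for N x
    using F0[of N x] unfolding R_def b_def by (cases "G x > 0"; cases "G x = 0") (auto simp: sgn_if)
  have Rle: "\<bar>R N x\<bar> \<le> \<bar>G x\<bar>" for N x using F0[of N x] by (simp add: Rabs)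
  have [measurable]: "R N \<in> borel_measurable lebesgue" for N unfolding R_def by measurable
  have R: "block p (ennreal \<sigma>) w (R N)" for N
    by (rule block_mono[OF s0 G]) (auto simp: Rle)
  note [measurable] = T_meas[OF c] T_meas[OF R] T_meas[OF G]
  have TR: "AE x in lebesgue. T (R N) x = T G x - (\<Sum>j<N. \<bar>\<mu> j\<bar> * T (c j) x)" for N
  proof -
    define A where "A j = (if j < N then c j else G)" for j
    define lam where "lam j = (if j < N then - \<bar>\<mu> j\<bar> else 1)" for j
    have "R N = (\<lambda>x. \<Sum>j<Suc N. lam j * A j x)"
      by (simp add: fun_eq_iff A_def lam_def R_def sum_c[symmetric] sum_negf)
    moreover have "\<forall>j<Suc N. block p (ennreal \<sigma>) w (A j)" using c G by (simp add: A_def)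
    ultimately have "AE x in lebesgue. T (R N) x = (\<Sum>j<Suc N. lam j * T (A j) x)"
      using lin R[of N] unfolding linear_on_blocks_def by blast
    then show ?thesis by eventually_elim (simp add: A_def lam_def sum_negf)
  qed
  have AE_ser: "AE x in lebesgue. (\<lambda>j. \<mu> j * a j x) sums G x"
  proof -
    have "AE x in lebesgue. 0 < w x \<longrightarrow> (\<lambda>j. \<mu> j * a j x) sums G x"
      using ser by (simp add: block_series_def AE_wm[OF w])
    with wpos show ?thesis by eventually_elim simp
  qed
  define I where "I N = (\<integral>\<^sup>+x. ennreal (\<bar>R N x\<bar> powr \<sigma>) \<partial>lebesgue)" for N
  have Gfin: "(\<integral>\<^sup>+x. ennreal (\<bar>G x\<bar> powr \<sigma>) \<partial>lebesgue) < top"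
    using G \<sigma> by (simp add: block_def Lspace_def Lnorm_finite_iff)
  have "I \<longlonglongrightarrow> (\<integral>\<^sup>+x. 0 \<partial>(lebesgue :: (real ^ 'n) measure))"
    unfolding I_def
  proof (rule nn_integral_dominated_convergence[where w="\<lambda>x. ennreal (\<bar>G x\<bar> powr \<sigma>)"])
    show "AE x in lebesgue. ennreal (\<bar>R N x\<bar> powr \<sigma>) \<le> ennreal (\<bar>G x\<bar> powr \<sigma>)" for N
      using \<sigma> Rle by (auto intro!: ennreal_leI powr_mono2)
    show "AE x in lebesgue. (\<lambda>N. ennreal (\<bar>R N x\<bar> powr \<sigma>)) \<longlonglongrightarrow> 0"
      using AE_ser
    proof eventually_elim
      case (elim x)
      have "(\<lambda>N. \<bar>\<Sum>j<N. \<mu> j * a j x\<bar>) \<longlonglongrightarrow> \<bar>G x\<bar>"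
        using elim unfolding sums_def by (rule tendsto_rabs)
      then have "(\<lambda>N. \<bar>G x\<bar> - min \<bar>G x\<bar> \<bar>\<Sum>j<N. \<mu> j * a j x\<bar>) \<longlonglongrightarrow> \<bar>G x\<bar> - min \<bar>G x\<bar> \<bar>G x\<bar>"
        by (intro tendsto_diff tendsto_min tendsto_const)
      then have lim: "(\<lambda>N. \<bar>G x\<bar> - min \<bar>G x\<bar> \<bar>\<Sum>j<N. \<mu> j * a j x\<bar>) \<longlonglongrightarrow> 0" by simp
      have le: "\<bar>R N x\<bar> \<le> \<bar>G x\<bar> - min \<bar>G x\<bar> \<bar>\<Sum>j<N. \<mu> j * a j x\<bar>" for N
      proof -
        have "\<bar>\<Sum>j<N. \<mu> j * a j x\<bar> \<le> F N x"
          unfolding F_def abs_mult[symmetric] by (rule sum_abs)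
        then show ?thesis by (simp add: Rabs)
      qed
      have "(\<lambda>N. \<bar>R N x\<bar>) \<longlonglongrightarrow> 0"
        by (rule tendsto_sandwich[OF _ _ tendsto_const lim]) (auto simp: le)
      then have "(\<lambda>N. \<bar>R N x\<bar> powr \<sigma>) \<longlonglongrightarrow> 0"
        using \<sigma> by (intro tendsto_zero_powrI[where b=\<sigma>]) auto
      then show ?case using tendsto_ennrealI by fastforce
    qed
  qed (use Gfin in \<open>auto simp: less_top\<close>)
  then have I0: "I \<longlonglongrightarrow> 0" by simp
  have Ifin: "I N < top" for N
  proof -
    have "I N \<le> (\<integral>\<^sup>+x. ennreal (\<bar>G x\<bar> powr \<sigma>) \<partial>lebesgue)"
      unfolding I_def using \<sigma> Rle by (intro nn_integral_mono ennreal_leI powr_mono2) auto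
    then show ?thesis using Gfin by (rule le_less_trans)
  qed
  define H where "H x = (\<Sum>j. ennreal (\<bar>\<mu> j\<bar> * \<bar>T (c j) x\<bar>))" for x
  \<comment> \<open>The excess of \<open>|T G|\<close> over the series lies below every \<open>|T R\<^sub>N|\<close>; it will be shown to vanish.\<close>
  define E where "E x = enn2real (ennreal \<bar>T G x\<bar> - H x)" for x
  have [measurable]: "H \<in> borel_measurable lebesgue" unfolding H_def by measurable
  have [measurable]: "E \<in> borel_measurable lebesgue" unfolding E_def by measurable
  have E_le: "AE x in lebesgue. E x \<le> \<bar>T (R N) x\<bar>" for N
    using TR[of N]
  proof eventually_elim
    case (elim x)
    have "\<bar>T G x\<bar> \<le> \<bar>T (R N) x\<bar> + (\<Sum>j<N. \<bar>\<mu> j\<bar> * \<bar>T (c j) x\<bar>)"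
    proof -
      have "\<bar>\<Sum>j<N. \<bar>\<mu> j\<bar> * T (c j) x\<bar> \<le> (\<Sum>j<N. \<bar>\<mu> j\<bar> * \<bar>T (c j) x\<bar>)"
        by (rule order_trans[OF sum_abs]) (simp add: abs_mult)
      then show ?thesis using elim by linarith
    qed
    then have "ennreal \<bar>T G x\<bar> \<le> ennreal (\<bar>T (R N) x\<bar> + (\<Sum>j<N. \<bar>\<mu> j\<bar> * \<bar>T (c j) x\<bar>))" by (rule ennreal_leI)
    also have "\<dots> = ennreal \<bar>T (R N) x\<bar> + (\<Sum>j<N. ennreal (\<bar>\<mu> j\<bar> * \<bar>T (c j) x\<bar>))"
      by (simp add: sum_nonneg sum_ennreal)
    also have "\<dots> \<le> ennreal \<bar>T (R N) x\<bar> + H x"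
      unfolding H_def by (intro add_left_mono sum_le_suminf) auto
    finally have "ennreal \<bar>T G x\<bar> - H x \<le> ennreal \<bar>T (R N) x\<bar>"
      by (simp add: ennreal_minus_le_iff add.commute)
    then show ?case unfolding E_def by (metis abs_ge_zero enn2real_leI)
  qed
  let ?d = "2 * sqrt (real CARD('n))"
  obtain c0 l0 where cl: "0 < l0" "closure {x. G x \<noteq> 0} \<subseteq> cube c0 l0"
    using G by (auto simp: block_def)
  obtain k0 :: nat where k0: "l0 + 2 * norm c0 \<le> real k0" using real_arch_simple by blast
  have E0: "AE x in lebesgue. x \<in> cube 0 (?d * real (k0 + k)) \<longrightarrow> E x = 0" for k
  proof -
    let ?L = "real (k0 + k)"
    have L: "0 < ?L" and sub: "closure {x. G x \<noteq> 0} \<subseteq> cube 0 ?L"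
    proof -
      have "l0 + 2 * norm c0 \<le> ?L" using k0 by simp
      moreover have "0 \<le> norm c0" by simp
      ultimately show "0 < ?L" "closure {x. G x \<noteq> 0} \<subseteq> cube 0 ?L"
        using cl cube_subset_centred[of l0 c0 ?L] by (linarith, blast)
    qed
    let ?Q = "cube 0 (?d * ?L) :: (real ^ 'n) set"
    have "(\<integral>\<^sup>+x\<in>?Q. ennreal (E x powr \<sigma>) \<partial>lebesgue) \<le> ennreal (C powr \<sigma>) * I N" for N
    proof -
      define i where "i = enn2real (I N) powr (1 / \<sigma>)"
      have i: "0 \<le> i" "ennreal (i powr \<sigma>) = I N"
        using Ifin[of N] \<sigma> by (auto simp: i_def powr_powr less_top)
      have subR: "closure {x. R N x \<noteq> 0} \<subseteq> cube 0 ?L"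
        using closure_support_mono[OF Rle] sub by (rule order_trans)
      have "Lnorm (lebesgue_on ?Q) (ennreal \<sigma>) (T (R N)) \<le> ennreal (C * i)"
        using \<sigma> i by (intro image_Lnorm_le[OF est C _ R L subR]) (auto simp: Lnorm_le_iff I_def[symmetric])
      then have "(\<integral>\<^sup>+x. ennreal (\<bar>T (R N) x\<bar> powr \<sigma>) \<partial>lebesgue_on ?Q) \<le> ennreal ((C * i) powr \<sigma>)"
        using \<sigma> C i by (subst (asm) Lnorm_le_iff) auto
      then have *: "(\<integral>\<^sup>+x\<in>?Q. ennreal (\<bar>T (R N) x\<bar> powr \<sigma>) \<partial>lebesgue) \<le> ennreal (C powr \<sigma>) * I N"
        using C i by (subst (asm) nn_integral_restrict_space) (auto simp: powr_mult ennreal_mult)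
      have "AE x in lebesgue. ennreal (E x powr \<sigma>) * indicator ?Q x \<le> ennreal (\<bar>T (R N) x\<bar> powr \<sigma>) * indicator ?Q x"
        using E_le[of N]
        by eventually_elim (use \<sigma> in \<open>auto intro!: mult_right_mono ennreal_leI powr_mono2 simp: E_def\<close>)
      then have "(\<integral>\<^sup>+x\<in>?Q. ennreal (E x powr \<sigma>) \<partial>lebesgue) \<le> (\<integral>\<^sup>+x\<in>?Q. ennreal (\<bar>T (R N) x\<bar> powr \<sigma>) \<partial>lebesgue)"
        by (rule nn_integral_mono_AE)
      then show ?thesis using * by (rule order_trans)
    qed
    moreover have "(\<lambda>N. ennreal (C powr \<sigma>) * I N) \<longlonglongrightarrow> ennreal (C powr \<sigma>) * 0"
      using I0 by (intro ennreal_tendsto_cmult) auto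
    ultimately have "(\<integral>\<^sup>+x\<in>?Q. ennreal (E x powr \<sigma>) \<partial>lebesgue) \<le> ennreal (C powr \<sigma>) * 0"
      by (intro LIMSEQ_le_const) auto
    then have "(\<integral>\<^sup>+x\<in>?Q. ennreal (E x powr \<sigma>) \<partial>lebesgue) = 0" by simp
    then have "AE x in lebesgue. ennreal (E x powr \<sigma>) * indicator ?Q x = 0"
      by (subst (asm) nn_integral_0_iff_AE) measurable
    then show ?thesis
      by eventually_elim (auto simp: ennreal_eq_0_iff split: split_indicator_asm)
  qed
  have "AE x in lebesgue. \<forall>k. x \<in> cube 0 (?d * real (k0 + k)) \<longrightarrow> E x = 0"
    using E0 by (subst AE_all_countable) blast
  then have "AE x in lebesgue. ennreal \<bar>T G x\<bar> \<le> H x"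
  proof eventually_elim
    case (elim x)
    obtain k :: nat where k: "x \<in> cube 0 (real k)" using ex_centred_cube by blast
    have "1 * real k \<le> ?d * real (k0 + k)"
      using two_sqrt_card_gt_1[where 'n='n] by (intro mult_mono) auto
    then have "x \<in> cube 0 (?d * real (k0 + k))" using k cube_mono by (metis mult_1 subsetD)
    then have "E x = 0" using elim by blast
    moreover have "ennreal \<bar>T G x\<bar> - H x < top"
      by (rule le_less_trans[OF diff_le_self_ennreal]) simp
    ultimately have "ennreal \<bar>T G x\<bar> - H x = 0" by (simp add: E_def enn2real_eq_0_iff)
    then show ?case by (simp add: diff_eq_0_iff_ennreal)
  qed
  then have "AE x in wm w. ennreal \<bar>T G x\<bar> \<le> (\<Sum>j. ennreal (\<bar>\<mu> j\<bar> * \<bar>T (c j) x\<bar>))"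
    unfolding H_def by (rule AE_wm_if_lebesgue[OF w])
  then show ?thesis using c by blast
qed

section \<open>Extension of the operator to block series\<close>

lemma linear_on_blocksD:
  fixes N :: nat
  assumes "linear_on_blocks p s w T" "block p s w h" "\<And>j. block p s w (a j)"
    and "h = (\<lambda>x. \<Sum>j<N. lam j * a j x)"
  shows "AE x in lebesgue. T h x = (\<Sum>j<N. lam j * T (a j) x)"
  using assms(1)[unfolded linear_on_blocks_def, THEN spec[of _ h], THEN spec[of _ a],
      THEN spec[of _ lam], THEN spec[of _ N]] assms(2-4) by blast

locale Lp_bounded_on_blocks =
  fixes p :: real and s :: ennreal and w :: "real ^ 'n \<Rightarrow> real"
    and T :: "(real ^ 'n \<Rightarrow> real) \<Rightarrow> real ^ 'n \<Rightarrow> real" and A :: real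
  assumes p: "0 < p" and s: "0 < s" and w: "weight w" and A: "0 \<le> A"
    and T_meas: "\<And>h. block p s w h \<Longrightarrow> T h \<in> borel_measurable lebesgue"
    and T_Lp: "\<And>h. block p s w h \<Longrightarrow> (\<integral>\<^sup>+x. ennreal (\<bar>T h x\<bar> powr p) \<partial>wm w) \<le> ennreal A"
begin

lemma exponent_pbar: "0 < min p 1" "1 \<le> p / min p 1" using p by (auto simp: min_def)

lemma borel_wm: "borel_measurable (wm w) = borel_measurable lebesgue"
  by (intro measurable_cong_sets) auto

lemma T_series:
  assumes "\<And>j. block p s w (a j)" "summable (\<lambda>j. \<bar>lam j\<bar> powr min p 1)"
  shows "AE x in wm w. summable (\<lambda>j. \<bar>lam j\<bar> * \<bar>T (a j) x\<bar>)"
    and "(\<integral>\<^sup>+x. ennreal ((\<Sum>j. \<bar>lam j\<bar> * \<bar>T (a j) x\<bar>) powr p) \<partial>wm w)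
      \<le> ennreal (A * (\<Sum>j. \<bar>lam j\<bar> powr min p 1) powr (p / min p 1))"
proof -
  have m: "T (a j) \<in> borel_measurable (wm w)" for j
    unfolding borel_wm by (rule T_meas[OF assms(1)])
  show "AE x in wm w. summable (\<lambda>j. \<bar>lam j\<bar> * \<bar>T (a j) x\<bar>)"
    by (rule Lp_series(1)[OF p A m T_Lp[OF assms(1)] assms(2)])
  show "(\<integral>\<^sup>+x. ennreal ((\<Sum>j. \<bar>lam j\<bar> * \<bar>T (a j) x\<bar>) powr p) \<partial>wm w)
      \<le> ennreal (A * (\<Sum>j. \<bar>lam j\<bar> powr min p 1) powr (p / min p 1))"
    by (rule Lp_series(2)[OF p A m T_Lp[OF assms(1)] assms(2)])
qed

lemma nn_integral_powr_le_of_series: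
  assumes a: "\<And>j. block p s w (a j)" and sl: "summable (\<lambda>j. \<bar>lam j\<bar> powr min p 1)"
    and dom: "AE x in wm w. ennreal \<bar>f x\<bar> \<le> (\<Sum>j. ennreal (\<bar>lam j\<bar> * \<bar>T (a j) x\<bar>))"
  shows "(\<integral>\<^sup>+x. ennreal (\<bar>f x\<bar> powr p) \<partial>wm w) \<le> ennreal (A * (\<Sum>j. \<bar>lam j\<bar> powr min p 1) powr (p / min p 1))"
proof -
  have "AE x in wm w. ennreal (\<bar>f x\<bar> powr p) \<le> ennreal ((\<Sum>j. \<bar>lam j\<bar> * \<bar>T (a j) x\<bar>) powr p)"
    using dom T_series(1)[of a lam, OF a sl]
  proof eventually_elim
    case (elim x)
    then have "ennreal \<bar>f x\<bar> \<le> ennreal (\<Sum>j. \<bar>lam j\<bar> * \<bar>T (a j) x\<bar>)"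
      by (simp add: suminf_ennreal2)
    moreover have "0 \<le> (\<Sum>j. \<bar>lam j\<bar> * \<bar>T (a j) x\<bar>)" using elim(2) by (intro suminf_nonneg) auto
    ultimately show ?case using p by (intro ennreal_leI powr_mono2) (auto simp: ennreal_le_iff)
  qed
  then have "(\<integral>\<^sup>+x. ennreal (\<bar>f x\<bar> powr p) \<partial>wm w)
      \<le> (\<integral>\<^sup>+x. ennreal ((\<Sum>j. \<bar>lam j\<bar> * \<bar>T (a j) x\<bar>) powr p) \<partial>wm w)"
    by (rule nn_integral_mono_AE)
  also note T_series(2)[of a lam, OF a sl]
  finally show ?thesis .
qed

text \<open>The bound holds with the same constant for every representation of \<open>f\<close>, hence for the infimum.\<close>

lemma bounded_if_series_dominated:
  assumes meas: "\<And>f. f \<in> BL p s w \<Longrightarrow> S f \<in> borel_measurable lebesgue"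
    and dom: "\<And>f lam a. block_series p s w lam a f \<Longrightarrow>
      AE x in wm w. ennreal \<bar>S f x\<bar> \<le> (\<Sum>j. ennreal (\<bar>lam j\<bar> * \<bar>T (a j) x\<bar>))"
  shows "bounded_BL_Lp p s w S"
proof -
  define e where "e = min p 1"
  have e: "0 < e" using exponent_pbar by (simp add: e_def)
  \<comment> \<open>The summand 1 makes the constant positive, so that it can be divided out of the infimum.\<close>
  define B where "B = A powr (1 / p) + 1"
  have B: "0 < B" by (simp add: B_def add_nonneg_pos)
  have le: "Lnorm (wm w) (ennreal p) (S f) \<le> ennreal (B * (\<Sum>j. \<bar>lam j\<bar> powr e) powr (1 / e))"
    if ser: "block_series p s w lam a f" for f lam a
  proof -
    define \<Lambda> where "\<Lambda> = (\<Sum>j. \<bar>lam j\<bar> powr e)"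
    have "(\<integral>\<^sup>+x. ennreal (\<bar>S f x\<bar> powr p) \<partial>wm w) \<le> ennreal (A * \<Lambda> powr (p / e))"
      unfolding \<Lambda>_def e_def
      by (rule nn_integral_powr_le_of_series[OF _ _ dom[OF ser]]) (use ser in \<open>auto simp: block_series_def\<close>)
    also have "A * \<Lambda> powr (p / e) \<le> (B * \<Lambda> powr (1 / e)) powr p"
    proof -
      have "A = (A powr (1 / p)) powr p" using A p by (simp add: powr_powr)
      also have "\<dots> \<le> B powr p" using p by (intro powr_mono2) (auto simp: B_def)
      finally show ?thesis using B by (simp add: powr_mult powr_powr mult_right_mono)
    qed
    finally show ?thesis
      using p B by (subst Lnorm_le_iff) (auto simp: \<Lambda>_def ennreal_leI)
  qed
  have bd: "Lnorm (wm w) (ennreal p) (S f) \<le> ennreal (B * BL_norm p s w f)" if f: "f \<in> BL p s w" for f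
  proof -
    define V where "V = {(\<Sum>j. \<bar>lam j\<bar> powr e) powr (1 / e) | lam a. block_series p s w lam a f}"
    have ne: "V \<noteq> {}" using f by (auto simp: V_def BL_def)
    have leV: "Lnorm (wm w) (ennreal p) (S f) \<le> ennreal (B * v)" if "v \<in> V" for v
      using that le by (auto simp: V_def)
    obtain N where N: "0 \<le> N" "Lnorm (wm w) (ennreal p) (S f) = ennreal N"
    proof (cases "Lnorm (wm w) (ennreal p) (S f)" rule: ennreal_cases)
      case top
      then show ?thesis using leV ne by (auto simp: top_unique)
    qed (use that in auto)
    have "N / B \<le> v" if "v \<in> V" for v
    proof -
      have "0 \<le> v" using that by (auto simp: V_def)
      then show ?thesis using leV[OF that] N B by (simp add: ennreal_le_iff pos_divide_le_eq mult.commute)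
    qed
    then have "N / B \<le> Inf V" using ne by (intro cInf_greatest)
    then have "N \<le> B * Inf V" using B by (simp add: field_simps)
    then show ?thesis by (simp add: N BL_norm_def V_def e_def ennreal_leI)
  qed
  have "Lnorm (wm w) (ennreal p) (S f) < top" if "f \<in> BL p s w" for f
    using bd[OF that] by (rule le_less_trans) simp
  then have "\<forall>f\<in>BL p s w. S f \<in> Lspace (wm w) (ennreal p)"
    using meas by (simp add: Lspace_def borel_wm)
  moreover have "\<forall>f\<in>BL p s w. Lnorm (wm w) (ennreal p) (S f) \<le> ennreal (B * BL_norm p s w f)"
    using bd by blast
  ultimately show ?thesis unfolding bounded_BL_Lp_def by (intro conjI exI[of _ B])
qed

end

lemma suminf_tail_tendsto_0:
  fixes f :: "nat \<Rightarrow> real"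
  assumes "summable f"
  shows "(\<lambda>N. \<Sum>j. f (j + N)) \<longlonglongrightarrow> 0"
proof -
  have "(\<lambda>N. suminf f - (\<Sum>j<N. f j)) \<longlonglongrightarrow> suminf f - suminf f"
    using assms by (intro tendsto_diff tendsto_const summable_LIMSEQ)
  then show ?thesis by (simp add: suminf_minus_initial_segment[OF assms])
qed

text \<open>The second assumption lets the norm of \<open>T G\<close> be estimated through any block series of \<open>G\<close>. The
  blocks \<open>c\<^sub>j\<close> may differ from the \<open>a\<^sub>j\<close>; only the coefficients matter.\<close>

locale linear_block_operator = Lp_bounded_on_blocks p s w T A
  for p s and w :: "real ^ 'n \<Rightarrow> real" and T A +
  assumes lin: "linear_on_blocks p s w T"
    and dom: "\<And>G \<mu> a. block p s w G \<Longrightarrow> block_series p s w \<mu> a G \<Longrightarrow>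
      \<exists>c. (\<forall>j. block p s w (c j)) \<and>
        (AE x in wm w. ennreal \<bar>T G x\<bar> \<le> (\<Sum>j. ennreal (\<bar>\<mu> j\<bar> * \<bar>T (c j) x\<bar>)))"
begin

lemma block_seriesD:
  assumes "block_series p s w lam a f"
  shows "block p s w (a j)" "summable (\<lambda>j. \<bar>lam j\<bar> powr min p 1)" "f \<in> borel_measurable lebesgue"
    "AE x in wm w. (\<lambda>j. lam j * a j x) sums f x"
    "T (a j) \<in> borel_measurable lebesgue"
    "AE x in wm w. summable (\<lambda>j. \<bar>lam j\<bar> * \<bar>T (a j) x\<bar>)"
    "AE x in wm w. (\<lambda>j. lam j * T (a j) x) sums (\<Sum>j. lam j * T (a j) x)"
proof -
  show 1: "block p s w (a j)" "summable (\<lambda>j. \<bar>lam j\<bar> powr min p 1)" "f \<in> borel_measurable lebesgue"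
    "AE x in wm w. (\<lambda>j. lam j * a j x) sums f x" for j
    using assms by (auto simp: block_series_def)
  then show "T (a j) \<in> borel_measurable lebesgue" for j using T_meas by blast
  show 2: "AE x in wm w. summable (\<lambda>j. \<bar>lam j\<bar> * \<bar>T (a j) x\<bar>)" using 1 by (intro T_series) auto
  show "AE x in wm w. (\<lambda>j. lam j * T (a j) x) sums (\<Sum>j. lam j * T (a j) x)"
    using 2
  proof eventually_elim
    case (elim x)
    then have "summable (\<lambda>j. \<bar>lam j * T (a j) x\<bar>)" by (simp add: abs_mult)
    then have "summable (\<lambda>j. lam j * T (a j) x)" by (rule summable_rabs_cancel)
    then show ?case by (rule summable_sums)
  qed
qed

text \<open>The partial sum, scaled to a block \<open>G\<close>, has two representations: the finite one, which finite
  linearity maps to the partial sum of the images, and minus the tail, which bounds \<open>T G\<close>.\<close>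

lemma partial_sums_of_zero:
  assumes ser: "block_series p s w lam a (\<lambda>x. 0)"
  shows "(\<integral>\<^sup>+x. ennreal (\<bar>\<Sum>j<N. lam j * T (a j) x\<bar> powr p) \<partial>wm w)
    \<le> ennreal (A * (\<Sum>j. \<bar>lam (j + N)\<bar> powr min p 1) powr (p / min p 1))"
proof -
  note D = block_seriesD[OF ser]
  note [measurable] = D(5)
  define e where "e = min p 1"
  have e: "0 < e" using exponent_pbar by (simp add: e_def)
  obtain k where k: "0 < k" and G: "block p s w (\<lambda>x. k * (\<Sum>j<N. lam j * a j x))"
    using finite_sum_scaled_block[where w=w and a=a and N=N and p=p and lam=lam, OF s D(1)] by blast
  define G where "G x = k * (\<Sum>j<N. lam j * a j x)" for x
  have G: "block p s w G" using G unfolding G_def .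
  have Gm: "G \<in> borel_measurable lebesgue" using G by (auto simp: block_def Lspace_def)
  define \<mu> where "\<mu> j = - k * lam (j + N)" for j
  have mu: "summable (\<lambda>j. \<bar>\<mu> j\<bar> powr e)" "(\<Sum>j. \<bar>\<mu> j\<bar> powr e) = k powr e * (\<Sum>j. \<bar>lam (j + N)\<bar> powr e)"
  proof -
    have eq: "\<bar>\<mu> j\<bar> powr e = k powr e * \<bar>lam (j + N)\<bar> powr e" for j
      using k by (simp add: \<mu>_def abs_mult powr_mult)
    have sm: "summable (\<lambda>j. \<bar>lam (j + N)\<bar> powr e)"
      using D(2) unfolding e_def by (rule summable_ignore_initial_segment)
    show "summable (\<lambda>j. \<bar>\<mu> j\<bar> powr e)" "(\<Sum>j. \<bar>\<mu> j\<bar> powr e) = k powr e * (\<Sum>j. \<bar>lam (j + N)\<bar> powr e)"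
      unfolding eq using sm by (auto intro: summable_mult suminf_mult)
  qed
  have tail: "block_series p s w \<mu> (\<lambda>j. a (j + N)) G"
    unfolding block_series_def
  proof (intro conjI allI)
    show "summable (\<lambda>j. \<bar>\<mu> j\<bar> powr min p 1)" using mu by (simp add: e_def)
    show "AE x in wm w. (\<lambda>j. \<mu> j * a (j + N) x) sums G x"
      using D(4)
    proof eventually_elim
      case (elim x)
      have "(\<lambda>j. lam (j + N) * a (j + N) x) sums (0 - (\<Sum>j<N. lam j * a j x))"
        using elim by (subst sums_iff_shift)simp
      then have "(\<lambda>j. (- k) * (lam (j + N) * a (j + N) x)) sums ((- k) * (0 - (\<Sum>j<N. lam j * a j x)))"
        by (rule sums_mult)
      then show ?case by (simp add: \<mu>_def G_def mult.assoc)
    qed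
  qed (use D(1) Gm in auto)
  have "\<exists>c. (\<forall>j. block p s w (c j)) \<and>
      (AE x in wm w. ennreal \<bar>T G x\<bar> \<le> (\<Sum>j. ennreal (\<bar>\<mu> j\<bar> * \<bar>T (c j) x\<bar>)))"
    by (rule dom[OF G tail])
  then obtain c where "(\<forall>j. block p s w (c j)) \<and>
      (AE x in wm w. ennreal \<bar>T G x\<bar> \<le> (\<Sum>j. ennreal (\<bar>\<mu> j\<bar> * \<bar>T (c j) x\<bar>)))"
    by (rule exE)
  note c = conjunct1[OF this, rule_format] conjunct2[OF this]
  have TG: "(\<integral>\<^sup>+x. ennreal (\<bar>T G x\<bar> powr p) \<partial>wm w) \<le> ennreal (A * (\<Sum>j. \<bar>\<mu> j\<bar> powr e) powr (p / e))"
    unfolding e_def by (rule nn_integral_powr_le_of_series[OF c(1) mu(1)[unfolded e_def] c(2)])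
  have "AE x in lebesgue. T G x = (\<Sum>j<N. (k * lam j) * T (a j) x)"
  proof -
    have "G = (\<lambda>x. \<Sum>j<N. (k * lam j) * a j x)"
      by (simp add: G_def fun_eq_iff sum_distrib_left mult.assoc)
    then show ?thesis by (rule linear_on_blocksD[OF lin G D(1)])
  qed
  then have "AE x in wm w. T G x = (\<Sum>j<N. (k * lam j) * T (a j) x)"
    by (rule AE_wm_if_lebesgue[OF w])
  then have "AE x in wm w. ennreal (\<bar>\<Sum>j<N. lam j * T (a j) x\<bar> powr p)
      = ennreal (1 / k powr p) * ennreal (\<bar>T G x\<bar> powr p)"
  proof eventually_elim
    case (elim x)
    then have "T G x = k * (\<Sum>j<N. lam j * T (a j) x)" by (simp add: sum_distrib_left mult.assoc)
    then show ?case using k by (simp add: abs_mult powr_mult ennreal_mult[symmetric])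
  qed
  then have "(\<integral>\<^sup>+x. ennreal (\<bar>\<Sum>j<N. lam j * T (a j) x\<bar> powr p) \<partial>wm w)
      = (\<integral>\<^sup>+x. ennreal (1 / k powr p) * ennreal (\<bar>T G x\<bar> powr p) \<partial>wm w)"
    by (rule nn_integral_cong_AE)
  also have "\<dots> = ennreal (1 / k powr p) * (\<integral>\<^sup>+x. ennreal (\<bar>T G x\<bar> powr p) \<partial>wm w)"
    using T_meas[OF G] by (intro nn_integral_cmult) (simp add: borel_wm)
  also have "\<dots> \<le> ennreal (1 / k powr p) * ennreal (A * (\<Sum>j. \<bar>\<mu> j\<bar> powr e) powr (p / e))"
    by (intro mult_left_mono TG) auto
  also have "\<dots> = ennreal (A * (\<Sum>j. \<bar>lam (j + N)\<bar> powr e) powr (p / e))"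
  proof -
    have "(\<Sum>j. \<bar>\<mu> j\<bar> powr e) powr (p / e) = k powr p * (\<Sum>j. \<bar>lam (j + N)\<bar> powr e) powr (p / e)"
      using e k by (simp add: mu(2) powr_mult powr_powr)
    then show ?thesis using A k by (simp add: ennreal_mult[symmetric])
  qed
  finally show ?thesis by (simp add: e_def)
qed

text \<open>Fatou's lemma carries the bound by the tail over to the sum of the images.\<close>

lemma image_of_zero_series:
  assumes ser: "block_series p s w lam a (\<lambda>x. 0)"
  shows "AE x in wm w. (\<lambda>j. lam j * T (a j) x) sums 0"
proof -
  note D = block_seriesD[OF ser]
  have [measurable]: "T (a j) \<in> borel_measurable (wm w)" for j using D(5) by (simp add: borel_wm)
  define S where "S x = (\<Sum>j. lam j * T (a j) x)" for x
  have [measurable]: "S \<in> borel_measurable (wm w)" unfolding S_def by measurable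
  define B where "B N = A * (\<Sum>j. \<bar>lam (j + N)\<bar> powr min p 1) powr (p / min p 1)" for N
  have "B \<longlonglongrightarrow> A * 0"
    unfolding B_def
  proof (intro tendsto_mult tendsto_const)
    have nn: "0 \<le> (\<Sum>j. \<bar>lam (j + N)\<bar> powr min p 1)" for N
      using D(2) by (intro suminf_nonneg summable_ignore_initial_segment) auto
    show "(\<lambda>N. (\<Sum>j. \<bar>lam (j + N)\<bar> powr min p 1) powr (p / min p 1)) \<longlonglongrightarrow> 0"
      using suminf_tail_tendsto_0[OF D(2)] exponent_pbar nn
      by (intro tendsto_zero_powrI[where b="p / min p 1"]) auto
  qed
  then have B0: "(\<lambda>N. ennreal (B N)) \<longlonglongrightarrow> 0" using tendsto_ennrealI by fastforce
  have "AE x in wm w. ennreal (\<bar>S x\<bar> powr p) = liminf (\<lambda>N. ennreal (\<bar>\<Sum>j<N. lam j * T (a j) x\<bar> powr p))"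
    using D(7)
  proof eventually_elim
    case (elim x)
    then have "(\<lambda>N. \<bar>\<Sum>j<N. lam j * T (a j) x\<bar>) \<longlonglongrightarrow> \<bar>S x\<bar>"
      unfolding sums_def S_def by (rule tendsto_rabs)
    then have "(\<lambda>N. \<bar>\<Sum>j<N. lam j * T (a j) x\<bar> powr p) \<longlonglongrightarrow> \<bar>S x\<bar> powr p"
      using p by (intro tendsto_powr2) auto
    then have "(\<lambda>N. ennreal (\<bar>\<Sum>j<N. lam j * T (a j) x\<bar> powr p)) \<longlonglongrightarrow> ennreal (\<bar>S x\<bar> powr p)"
      by (rule tendsto_ennrealI)
    then show ?case by (rule lim_imp_Liminf[OF trivial_limit_sequentially, symmetric])
  qed
  then have "(\<integral>\<^sup>+x. ennreal (\<bar>S x\<bar> powr p) \<partial>wm w)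
      = (\<integral>\<^sup>+x. liminf (\<lambda>N. ennreal (\<bar>\<Sum>j<N. lam j * T (a j) x\<bar> powr p)) \<partial>wm w)"
    by (rule nn_integral_cong_AE)
  also have "\<dots> \<le> liminf (\<lambda>N. \<integral>\<^sup>+x. ennreal (\<bar>\<Sum>j<N. lam j * T (a j) x\<bar> powr p) \<partial>wm w)"
    by (intro nn_integral_liminf) measurable
  also have "\<dots> \<le> liminf (\<lambda>N. ennreal (B N))"
    unfolding B_def by (intro Liminf_mono always_eventually allI partial_sums_of_zero[OF ser])
  also have "\<dots> = 0" using B0 by (rule lim_imp_Liminf[OF trivial_limit_sequentially])
  finally have "(\<integral>\<^sup>+x. ennreal (\<bar>S x\<bar> powr p) \<partial>wm w) = 0" by simp
  then have "AE x in wm w. ennreal (\<bar>S x\<bar> powr p) = 0"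
    by (subst (asm) nn_integral_0_iff_AE) measurable
  with D(7) show ?thesis
    by eventually_elim (auto simp: S_def[symmetric] ennreal_eq_0_iff)
qed

text \<open>Interleaving two block series represents a linear combination of their sums.\<close>

lemma block_series_combination:
  assumes f: "block_series p s w lam a f" and g: "block_series p s w mu b g"
  shows "block_series p s w (\<lambda>n. if even n then u * lam (n div 2) else v * mu ((n - 1) div 2))
    (\<lambda>n. if even n then a (n div 2) else b ((n - 1) div 2)) (\<lambda>x. u * f x + v * g x)"
  unfolding block_series_def
proof (intro conjI allI)
  note F = block_seriesD[OF f] and G = block_seriesD[OF g]
  note [measurable] = F(3) G(3)
  define e where "e = min p 1"
  show "block p s w (if even n then a (n div 2) else b ((n - 1) div 2))" for n using F(1) G(1) by simp
  show "(\<lambda>x. u * f x + v * g x) \<in> borel_measurable lebesgue" by measurable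
  have "summable (\<lambda>j. \<bar>u * lam j\<bar> powr e)" "summable (\<lambda>j. \<bar>v * mu j\<bar> powr e)"
    using F(2) G(2) by (simp_all add: abs_mult powr_mult summable_mult e_def)
  from sums_if[OF summable_sums[OF this(2)] summable_sums[OF this(1)]]
  have "summable (\<lambda>n. if even n then \<bar>u * lam (n div 2)\<bar> powr e else \<bar>v * mu ((n - 1) div 2)\<bar> powr e)"
    by (rule sums_summable)
  moreover have "(\<lambda>n. \<bar>if even n then u * lam (n div 2) else v * mu ((n - 1) div 2)\<bar> powr min p 1)
      = (\<lambda>n. if even n then \<bar>u * lam (n div 2)\<bar> powr e else \<bar>v * mu ((n - 1) div 2)\<bar> powr e)"
    unfolding e_def by (rule HOL.ext) simp
  ultimately show "summable (\<lambda>n. \<bar>if even n then u * lam (n div 2) else v * mu ((n - 1) div 2)\<bar> powr min p 1)"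
    by (simp only:)
  show "AE x in wm w. (\<lambda>n. (if even n then u * lam (n div 2) else v * mu ((n - 1) div 2)) *
      (if even n then a (n div 2) else b ((n - 1) div 2)) x) sums (u * f x + v * g x)"
    using F(4) G(4)
  proof eventually_elim
    case (elim x)
    from sums_if[OF sums_mult[OF elim(2), of v] sums_mult[OF elim(1), of u]]
    have "(\<lambda>n. if even n then u * (lam (n div 2) * a (n div 2) x) else v * (mu ((n - 1) div 2) * b ((n - 1) div 2) x))
       sums (u * f x + v * g x)" by (simp add: add.commute)
    moreover have "(\<lambda>n. (if even n then u * lam (n div 2) else v * mu ((n - 1) div 2)) *
        (if even n then a (n div 2) else b ((n - 1) div 2)) x)
      = (\<lambda>n. if even n then u * (lam (n div 2) * a (n div 2) x) else v * (mu ((n - 1) div 2) * b ((n - 1) div 2) x))"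
      by (rule HOL.ext) simp
    ultimately show ?case by (simp only:)
  qed
qed

lemma image_of_combination:
  assumes f: "block_series p s w lam a f" and g: "block_series p s w mu b g"
  shows "AE x in wm w. (\<lambda>n. (if even n then u * lam (n div 2) else v * mu ((n - 1) div 2)) *
      T (if even n then a (n div 2) else b ((n - 1) div 2)) x)
    sums (u * (\<Sum>j. lam j * T (a j) x) + v * (\<Sum>j. mu j * T (b j) x))"
  using block_seriesD(7)[OF f] block_seriesD(7)[OF g]
proof eventually_elim
  case (elim x)
  from sums_if[OF sums_mult[OF elim(2), of v] sums_mult[OF elim(1), of u]]
  have "(\<lambda>n. if even n then u * (lam (n div 2) * T (a (n div 2)) x)
        else v * (mu ((n - 1) div 2) * T (b ((n - 1) div 2)) x))
     sums (u * (\<Sum>j. lam j * T (a j) x) + v * (\<Sum>j. mu j * T (b j) x))" by (simp add: add.commute)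
  moreover have "(\<lambda>n. (if even n then u * lam (n div 2) else v * mu ((n - 1) div 2)) *
      T (if even n then a (n div 2) else b ((n - 1) div 2)) x)
    = (\<lambda>n. if even n then u * (lam (n div 2) * T (a (n div 2)) x)
        else v * (mu ((n - 1) div 2) * T (b ((n - 1) div 2)) x))"
    by (rule HOL.ext) simp
  ultimately show ?case by (simp only:)
qed

text \<open>The difference of the two series, interleaved, is a block series of \<open>0\<close>.\<close>

lemma image_unique:
  assumes f: "block_series p s w lam a f" and g: "block_series p s w mu b g"
    and eq: "AE x in wm w. f x = g x"
  shows "AE x in wm w. (\<Sum>j. lam j * T (a j) x) = (\<Sum>j. mu j * T (b j) x)"
proof -
  let ?l = "\<lambda>n. if even n then 1 * lam (n div 2) else (- 1) * mu ((n - 1) div 2)"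
  let ?a = "\<lambda>n. if even n then a (n div 2) else b ((n - 1) div 2)"
  have c: "block_series p s w ?l ?a (\<lambda>x. 1 * f x + (- 1) * g x)"
    by (rule block_series_combination[OF f g])
  have "AE x in wm w. (\<lambda>n. ?l n * ?a n x) sums 0"
    using eq block_seriesD(4)[OF c]
  proof eventually_elim
    case (elim x)
    have "1 * f x + (- 1) * g x = 0" using elim(1) by simp
    with elim(2) show ?case by (simp only:)
  qed
  then have "block_series p s w ?l ?a (\<lambda>x. 0)"
    using c unfolding block_series_def by auto
  from image_of_zero_series[OF this] image_of_combination[OF f g, of 1 "- 1"]
  show ?thesis
  proof eventually_elim
    case (elim x)
    from sums_unique2[OF elim] show ?case by simp
  qed
qed

definition extension :: "(real ^ 'n \<Rightarrow> real) \<Rightarrow> real ^ 'n \<Rightarrow> real" where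
  "extension f = (let r = (SOME r. block_series p s w (fst r) (snd r) f)
    in (\<lambda>x. \<Sum>j. fst r j * T (snd r j) x))"

lemma extension_representation:
  assumes "f \<in> BL p s w"
  obtains lam a where "block_series p s w lam a f" "extension f = (\<lambda>x. \<Sum>j. lam j * T (a j) x)"
proof -
  define r where "r = (SOME r. block_series p s w (fst r) (snd r) f)"
  obtain lam a where "block_series p s w lam a f" using assms by (auto simp: BL_def)
  then have "block_series p s w (fst (lam, a)) (snd (lam, a)) f" by simp
  then have "block_series p s w (fst r) (snd r) f" unfolding r_def by (rule someI)
  moreover have "extension f = (\<lambda>x. \<Sum>j. fst r j * T (snd r j) x)" by (simp add: extension_def r_def Let_def)
  ultimately show ?thesis by (rule that)
qed

lemma extension_eq_series:
  assumes ser: "block_series p s w lam a f"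
  shows "AE x in wm w. extension f x = (\<Sum>j. lam j * T (a j) x)"
proof -
  have "f \<in> BL p s w" using ser by (auto simp: BL_def)
  then obtain mu b where mu: "block_series p s w mu b f" "extension f = (\<lambda>x. \<Sum>j. mu j * T (b j) x)"
    by (rule extension_representation)
  show ?thesis unfolding mu(2) by (rule image_unique[OF mu(1) ser]) simp
qed

lemma extension_sums:
  assumes ser: "block_series p s w lam a f"
  shows "AE x in wm w. (\<lambda>j. lam j * T (a j) x) sums extension f x"
  using extension_eq_series[OF ser] block_seriesD(7)[OF ser] by eventually_elim simp

lemma extension_tail:
  assumes ser: "block_series p s w lam a f"
  shows "(\<lambda>N. Lnorm (wm w) (ennreal p) (\<lambda>x. (\<Sum>j<N. lam j * T (a j) x) - extension f x)) \<longlonglongrightarrow> 0"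
proof -
  note D = block_seriesD[OF ser]
  define e where "e = min p 1"
  have e: "0 < e" using exponent_pbar by (simp add: e_def)
  define \<Lambda> where "\<Lambda> N = (\<Sum>j. \<bar>lam (j + N)\<bar> powr e)" for N
  have sN: "summable (\<lambda>j. \<bar>lam (j + N)\<bar> powr e)" for N
    using D(2) unfolding e_def by (rule summable_ignore_initial_segment)
  have \<Lambda>: "0 \<le> \<Lambda> N" for N unfolding \<Lambda>_def using sN by (intro suminf_nonneg) auto
  define b where "b N = A powr (1 / p) * \<Lambda> N powr (1 / e)" for N
  have bound: "Lnorm (wm w) (ennreal p) (\<lambda>x. (\<Sum>j<N. lam j * T (a j) x) - extension f x) \<le> ennreal (b N)" for N
  proof -
    have "AE x in wm w. ennreal \<bar>(\<Sum>j<N. lam j * T (a j) x) - extension f x\<bar>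
        \<le> (\<Sum>j. ennreal (\<bar>lam (j + N)\<bar> * \<bar>T (a (j + N)) x\<bar>))"
      using D(6) extension_sums[OF ser]
    proof eventually_elim
      case (elim x)
      have sm: "summable (\<lambda>j. \<bar>lam (j + N) * T (a (j + N)) x\<bar>)"
        using elim(1) summable_ignore_initial_segment[of "\<lambda>j. \<bar>lam j * T (a j) x\<bar>" N]
        by (simp add: abs_mult)
      have "(\<lambda>j. lam (j + N) * T (a (j + N)) x) sums (extension f x - (\<Sum>j<N. lam j * T (a j) x))"
        using elim(2) by (subst sums_iff_shift) simp
      then have "extension f x - (\<Sum>j<N. lam j * T (a j) x) = (\<Sum>j. lam (j + N) * T (a (j + N)) x)"
        by (rule sums_unique)
      then have "\<bar>(\<Sum>j<N. lam j * T (a j) x) - extension f x\<bar> \<le> (\<Sum>j. \<bar>lam (j + N) * T (a (j + N)) x\<bar>)"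
        using summable_rabs[OF sm] by (simp add: abs_minus_commute)
      then have "ennreal \<bar>(\<Sum>j<N. lam j * T (a j) x) - extension f x\<bar> \<le> ennreal (\<Sum>j. \<bar>lam (j + N) * T (a (j + N)) x\<bar>)"
        by (rule ennreal_leI)
      also have "\<dots> = (\<Sum>j. ennreal \<bar>lam (j + N) * T (a (j + N)) x\<bar>)"
        using sm by (subst suminf_ennreal2) auto
      finally show ?case by (simp add: abs_mult)
    qed
    then have "(\<integral>\<^sup>+x. ennreal (\<bar>(\<Sum>j<N. lam j * T (a j) x) - extension f x\<bar> powr p) \<partial>wm w)
       \<le> ennreal (A * \<Lambda> N powr (p / e))"
      unfolding \<Lambda>_def e_def using D(1) sN[unfolded e_def] by (intro nn_integral_powr_le_of_series)
    also have "A * \<Lambda> N powr (p / e) = b N powr p"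
      using A p by (simp add: b_def powr_mult powr_powr)
    finally show ?thesis using p by (subst Lnorm_le_iff) (auto simp: b_def)
  qed
  have lim: "(\<lambda>N. ennreal (b N)) \<longlonglongrightarrow> 0"
  proof -
    have "(\<lambda>N. \<Lambda> N powr (1 / e)) \<longlonglongrightarrow> 0"
      using suminf_tail_tendsto_0[OF D(2)] e \<Lambda> unfolding \<Lambda>_def e_def[symmetric]
      by (intro tendsto_zero_powrI[where b="1 / e"]) auto
    then have "b \<longlonglongrightarrow> A powr (1 / p) * 0"
      unfolding b_def by (intro tendsto_mult tendsto_const)
    then show ?thesis using tendsto_ennrealI by fastforce
  qed
  show ?thesis
    by (rule tendsto_sandwich[OF _ _ tendsto_const lim]) (simp_all add: bound)
qed

lemma block_series_single:
  assumes h: "block p s w h"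
  shows "block_series p s w (\<lambda>j. if j = 0 then 1 else 0) (\<lambda>_. h) h"
  unfolding block_series_def
proof (intro conjI allI)
  have eq: "(\<lambda>j::nat. \<bar>if j = 0 then 1 else 0 :: real\<bar> powr min p 1) = (\<lambda>j. if j = 0 then 1 else 0)"
    by auto
  show "summable (\<lambda>j::nat. \<bar>if j = 0 then 1 else 0 :: real\<bar> powr min p 1)"
    unfolding eq by simp
  show "h \<in> borel_measurable lebesgue" using h by (auto simp: block_def Lspace_def)
  have "(\<lambda>j. (if j = 0 then 1 else 0) * h x) sums h x" for x
    using sums_single[of 0 "\<lambda>_. h x"] by (simp add: if_distrib[of "\<lambda>t. t * _"] cong: if_cong)
  then show "AE x in wm w. (\<lambda>j. (if j = 0 then 1 else 0) * h x) sums h x" by simp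
qed (rule h)

lemma extension_is_bounded_series_extension: "bounded_series_extension p s w T extension"
  unfolding bounded_series_extension_def
proof (intro conjI ballI allI impI)
  fix f g assume f: "f \<in> BL p s w" and g: "g \<in> BL p s w"
  obtain lam a where la: "block_series p s w lam a f" "extension f = (\<lambda>x. \<Sum>j. lam j * T (a j) x)"
    using extension_representation[OF f] .
  obtain mu b where mb: "block_series p s w mu b g" "extension g = (\<lambda>x. \<Sum>j. mu j * T (b j) x)"
    using extension_representation[OF g] .
  show "AE x in wm w. extension f x = extension g x" if "AE x in wm w. f x = g x"
    unfolding la(2) mb(2) by (rule image_unique[OF la(1) mb(1) that])
  fix u v
  from extension_sums[OF block_series_combination[OF la(1) mb(1), of u v]]
    image_of_combination[OF la(1) mb(1), of u v]
  show "AE x in wm w. extension (\<lambda>y. u * f y + v * g y) x = u * extension f x + v * extension g x"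
    unfolding la(2) mb(2) by eventually_elim (rule sums_unique2)
next
  fix h assume h: "block p s w h"
  have "(\<lambda>j. (if j = 0 then 1 else 0) * T h x) sums T h x" for x
    using sums_single[of 0 "\<lambda>_. T h x"] by (simp add: if_distrib[of "\<lambda>t. t * _"] cong: if_cong)
  with extension_sums[OF block_series_single[OF h]]
  show "AE x in wm w. extension h x = T h x"
    by (auto elim!: eventually_mono intro: sums_unique2)
next
  show "bounded_BL_Lp p s w extension"
  proof (rule bounded_if_series_dominated)
    fix f assume "f \<in> BL p s w"
    then obtain lam a where la: "block_series p s w lam a f" "extension f = (\<lambda>x. \<Sum>j. lam j * T (a j) x)"
      by (rule extension_representation)
    note [measurable] = block_seriesD(5)[OF la(1)]
    show "extension f \<in> borel_measurable lebesgue" unfolding la(2) by measurable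
  next
    fix f lam a assume ser: "block_series p s w lam a f"
    from extension_eq_series[OF ser] block_seriesD(6)[OF ser]
    show "AE x in wm w. ennreal \<bar>extension f x\<bar> \<le> (\<Sum>j. ennreal (\<bar>lam j\<bar> * \<bar>T (a j) x\<bar>))"
    proof eventually_elim
      case (elim x)
      then have sm: "summable (\<lambda>j. \<bar>lam j * T (a j) x\<bar>)" by (simp add: abs_mult)
      have "ennreal \<bar>extension f x\<bar> \<le> ennreal (\<Sum>j. \<bar>lam j * T (a j) x\<bar>)"
        unfolding elim(1) by (intro ennreal_leI summable_rabs sm)
      also have "\<dots> = (\<Sum>j. ennreal \<bar>lam j * T (a j) x\<bar>)"
        using sm by (subst suminf_ennreal2) auto
      finally show ?case by (simp add: abs_mult)
    qed
  qed
next
  fix f lam a assume ser: "block_series p s w lam a f"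
  show "AE x in wm w. (\<lambda>j. lam j * T (a j) x) sums extension f x" by (rule extension_sums[OF ser])
  show "(\<lambda>N. Lnorm (wm w) (ennreal p) (\<lambda>x. (\<Sum>j<N. lam j * T (a j) x) - extension f x)) \<longlonglongrightarrow> 0"
    by (rule extension_tail[OF ser])
qed

end

section \<open>Boundedness on the block space\<close>

theorem theorem1p10:
  fixes w :: "real ^ 'n \<Rightarrow> real" and p :: real and s :: ennreal
    and T :: "(real ^ 'n \<Rightarrow> real) \<Rightarrow> real ^ 'n \<Rightarrow> real"
  assumes p: "0 < p" and w: "weight w"
    and cases:
      "(\<exists>q. 0 < q \<and> q < p \<and> D_class q w \<and> s = top) \<or>
       (\<exists>q r. 0 < q \<and> q < p \<and> 1 < r \<and> A_class q r w \<and> ennreal (max (r * p / (r - 1)) 1) \<le> s)"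
    and T_meas: "\<And>h. block p s w h \<Longrightarrow> T h \<in> borel_measurable lebesgue"
    and T_est: "\<exists>C. block_estimates p s w C T"
  shows
    "(linear_on_blocks p s w T \<and> (s = top \<longrightarrow> series_dominated p s w {h. block p s w h} T) \<longrightarrow>
        (\<exists>S. bounded_series_extension p s w T S \<and>
          (\<forall>S'. bounded_series_extension p s w T S' \<longrightarrow>
             (\<forall>f\<in>BL p s w. AE x in wm w. S' f x = S f x)))) \<and>
     ((\<forall>f\<in>BL p s w. T f \<in> borel_measurable lebesgue) \<and>
      sublinear_on_BL p s w T \<and> series_dominated p s w (BL p s w) T \<longrightarrow>
        bounded_BL_Lp p s w T)"
proof -
  obtain C0 where "block_estimates p s w C0 T" using T_est by blast
  then have est: "block_estimates p s w (max C0 0) T" by (rule block_estimates_nonneg)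
  have s_ge_1: "1 \<le> s"
  proof -
    have "1 \<le> ennreal (max b 1)" for b using ennreal_leI[of 1 "max b 1"] by simp
    then show ?thesis using cases by (metis order_trans top_greatest)
  qed
  obtain A where A: "0 \<le> A" "\<And>h. block p s w h \<Longrightarrow> (\<integral>\<^sup>+x. ennreal (\<bar>T h x\<bar> powr p) \<partial>wm w) \<le> ennreal A"
    using block_image_Lp[OF p w est cases T_meas] by blast
  interpret Lp_bounded_on_blocks p s w T A
    by unfold_locales (fact p less_le_trans[OF ennreal_zero_less_one s_ge_1] w A(1) T_meas A(2))+
  show ?thesis
  proof (intro conjI impI)
    assume lin: "linear_on_blocks p s w T \<and> (s = top \<longrightarrow> series_dominated p s w {h. block p s w h} T)"
    interpret linear_block_operator p s w T A
    proof
      show "linear_on_blocks p s w T" using lin by blast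
      fix G \<mu> a assume G: "block p s w G" and ser: "block_series p s w \<mu> a G"
      have blocks: "\<forall>j. block p s w (a j)" using ser by (simp add: block_series_def)
      show "\<exists>c. (\<forall>j. block p s w (c j)) \<and>
        (AE x in wm w. ennreal \<bar>T G x\<bar> \<le> (\<Sum>j. ennreal (\<bar>\<mu> j\<bar> * \<bar>T (c j) x\<bar>)))"
      proof (cases "s = top")
        case True
        then have sd: "series_dominated p s w {h. block p s w h} T" using lin by simp
        have "AE x in wm w. ennreal \<bar>T G x\<bar> \<le> (\<Sum>j. ennreal (\<bar>\<mu> j\<bar> * \<bar>T (a j) x\<bar>))"
          by (rule sd[unfolded series_dominated_def, rule_format, OF _ ser]) (simp add: G)
        with blocks show ?thesis by (intro exI[of _ a] conjI)
      next
        case False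
        then obtain q r where qr: "D_class q w" "1 < r" "RH_class r w"
          using cases by (auto simp: A_class_def)
        obtain \<sigma> where \<sigma>: "s = ennreal \<sigma>" "1 \<le> \<sigma>" using exponent_cases[OF s_ge_1] False by metis
        show ?thesis
          using wm_null_or_positive[OF w qr(1)]
        proof
          assume null: "AE x in wm w. False"
          then have "AE x in wm w. ennreal \<bar>T G x\<bar> \<le> (\<Sum>j. ennreal (\<bar>\<mu> j\<bar> * \<bar>T (a j) x\<bar>))"
            by (rule eventually_mono) simp
          with blocks show ?thesis by (intro exI[of _ a] conjI)
        next
          assume pos: "\<forall>c l. 0 < l \<longrightarrow> 0 < measure (wm w) (cube c l)"
          have wpos: "AE x in lebesgue. 0 < w x"
            by (rule weight_positive_AE[OF w qr(3,2)]) (simp add: pos)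
          show ?thesis
            unfolding \<sigma>(1)
            by (rule dominated_by_truncated_blocks[OF \<sigma>(2) w wpos est[unfolded \<sigma>(1)] _
                  T_meas[unfolded \<sigma>(1)] conjunct1[OF lin, unfolded \<sigma>(1)] G[unfolded \<sigma>(1)] ser[unfolded \<sigma>(1)]]) simp_all
        qed
      qed
    qed
    show "\<exists>S. bounded_series_extension p s w T S \<and>
        (\<forall>S'. bounded_series_extension p s w T S' \<longrightarrow> (\<forall>f\<in>BL p s w. AE x in wm w. S' f x = S f x))"
    proof (intro exI[of _ extension] conjI allI impI ballI)
      show "bounded_series_extension p s w T extension" by (rule extension_is_bounded_series_extension)
      fix S' f assume S': "bounded_series_extension p s w T S'" and f: "f \<in> BL p s w"
      obtain lam a where ser: "block_series p s w lam a f" using f by (auto simp: BL_def)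
      then have "AE x in wm w. (\<lambda>j. lam j * T (a j) x) sums S' f x"
        using S' unfolding bounded_series_extension_def by blast
      with extension_sums[OF ser] show "AE x in wm w. S' f x = extension f x"
        by eventually_elim (rule sums_unique2)
    qed
  next
    assume T: "(\<forall>f\<in>BL p s w. T f \<in> borel_measurable lebesgue) \<and>
      sublinear_on_BL p s w T \<and> series_dominated p s w (BL p s w) T"
    show "bounded_BL_Lp p s w T"
    proof (rule bounded_if_series_dominated)
      show "T f \<in> borel_measurable lebesgue" if "f \<in> BL p s w" for f using T that by blast
      show "AE x in wm w. ennreal \<bar>T f x\<bar> \<le> (\<Sum>j. ennreal (\<bar>lam j\<bar> * \<bar>T (a j) x\<bar>))"
        if "block_series p s w lam a f" for f lam a
        using T that unfolding series_dominated_def BL_def by blast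
    qed
  qed
qed

end
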